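(* Let $\mathcal{D}\subset\mathbb{R}^2$ be a domain and let $f(u,v)>0$, $\lambda_1(u,v)$ and $\mu_1(u,v)\neq0$ be three smooth functions defined on $\mathcal{D}$, with $(\ln f^2)_{uv}>0$ on $\mathcal{D}$ (the inequalities holding at every point), satisfying the conditions (i) $\bigl(f^{-2}(\ln f^2)_{uv}\bigr)_v=0$; (ii) $(\lambda_1)_v+\lambda_1(\ln f^2)_v+\Bigl(f^{-1}\sqrt{(\ln f^2)_{uv}}\Bigr)_u=0$; (iii) $(\mu_1)_{vv}+(\mu_1)_v(\ln f^2)_v+\mu_1(\ln f^2)_{vv}=0$. Let $(u_0,v_0)\in\mathcal{D}$, let $p_0\in\mathbb{R}^4_1$, and let $\{x_0,y_0,(n_1)_0,(n_2)_0\}$ be a pseudo-orthonormal frame at $p_0$. Then there exist a subdomain $\mathcal{D}_0\subset\mathcal{D}$ containing $(u_0,v_0)$ and a unique timelike surface of third type $\mathcal{M}^2: z=z(u,v)$, $(u,v)\in\mathcal{D}_0$, parametrized by isotropic parameters $(u,v)$, such that $z(u_0,v_0)=p_0$, $\{x_0,y_0,(n_1)_0,(n_2)_0\}$ is the geometric frame of $\mathcal{M}^2$ at $p_0=z(u_0,v_0)$, and $f,\lambda_1,\mu_1$ (restricted to $\mathcal{D}_0$) are the corresponding functions of $\mathcal{M}^2$ associated with its geometric frame field.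
   Context: $\mathbb{R}^4_1$ is the four-dimensional Minkowski space with the flat metric $\langle\cdot,\cdot\rangle = dx_1^2+dx_2^2+dx_3^2-dx_4^2$. All functions are $C^\infty$; subscripts $u,v$ on functions denote partial derivatives (for indexed functions, e.g. $(\lambda_1)_u=\partial\lambda_1/\partial u$). A domain is a nonempty connected open set. A pseudo-orthonormal frame at a point is a basis $\{x,y,n_1,n_2\}$ of $\mathbb{R}^4_1$ with $\langle x,x\rangle=\langle y,y\rangle=0$, $\langle x,y\rangle=-1$, $\langle n_1,n_1\rangle=\langle n_2,n_2\rangle=1$, and $\langle n_1,n_2\rangle=\langle x,n_i\rangle=\langle y,n_i\rangle=0$ for $i=1,2$. A surface $\mathcal{M}^2:z=z(u,v)$ is a smooth immersion of a domain in $\mathbb{R}^2$ into $\mathbb{R}^4_1$; it is timelike if $\langle\cdot,\cdot\rangle$ restricted to each tangent plane is indefinite (Lorentzian). The parameters $(u,v)$ are isotropic, with metric function $f>0$, if $\langle z_u,z_u\rangle=0$, $\langle z_v,z_v\rangle=0$, $\langle z_u,z_v\rangle=-f^2(u,v)$. Let $\widetilde\nabla$ be the flat connection of $\mathbb{R}^4_1$, $\sigma$ the second fundamental tensor (the normal part of $\widetilde\nabla$ on tangent fields), and $H=\frac12\operatorname{tr}\sigma$ the mean curvature vector field. Only surfaces free of minimal points ($H\neq0$ everywhere) are considered. Geometric frame field and associated functions: for a timelike surface free of minimal points in isotropic parameters put $x=z_u/f$, $y=z_v/f$ (so $H=-\sigma(x,y)$); let $\nu=\|H\|=\sqrt{\langle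 H,H\rangle}>0$ and $n_1=H/\nu$; let $n_2$ be a smooth unit normal field such that $\{n_1,n_2\}$ is an orthonormal frame field of the normal bundle ($n_2$ is determined up to sign, and either choice is allowed). Then $\{x,y,n_1,n_2\}$ is a geometric frame field of the surface, and its associated functions are $f$, $\nu$ and $\lambda_1,\mu_1,\lambda_2,\mu_2$, where $\sigma(x,x)=\lambda_1n_1+\mu_1n_2$, $\sigma(x,y)=-\nu n_1$, $\sigma(y,y)=\lambda_2n_1+\mu_2n_2$. The surface is of third type if $\mu_1\neq0$ at every point, $\mu_2=0$ and $\lambda_2=0$. *)

theory Defs
  imports "HOL-Analysis.Analysis"
begin

definition planar_domain :: "(real \<times> real) set \<Rightarrow> bool" where
  "planar_domain D \<longleftrightarrow> open D \<and> connected D \<and> D \<noteq> {}"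

text \<open>The order-\<open>k\<close> notion and \<open>smooth_on\<close> are meant for open \<open>S\<close>; the values of \<open>g\<close> outside \<open>S\<close> are then irrelevant.\<close>

primrec ck_on :: "nat \<Rightarrow> ('a::real_normed_vector \<Rightarrow> 'b::real_normed_vector) \<Rightarrow> 'a set \<Rightarrow> bool" where
  "ck_on 0 g S \<longleftrightarrow> continuous_on S g"
| "ck_on (Suc k) g S \<longleftrightarrow> (\<forall>p\<in>S. g differentiable (at p)) \<and>
     (\<forall>h. ck_on k (\<lambda>p. frechet_derivative g (at p) h) S)"

definition smooth_on :: "('a::real_normed_vector \<Rightarrow> 'b::real_normed_vector) \<Rightarrow> 'a set \<Rightarrow> bool" where
  "smooth_on g S \<longleftrightarrow> (\<forall>k. ck_on k g S)"

definition pd_u :: "(real \<times> real \<Rightarrow> 'a::real_normed_vector) \<Rightarrow> real \<times> real \<Rightarrow> 'a" where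
  "pd_u g p = vector_derivative (\<lambda>t. g (t, snd p)) (at (fst p))"

definition pd_v :: "(real \<times> real \<Rightarrow> 'a::real_normed_vector) \<Rightarrow> real \<times> real \<Rightarrow> 'a" where
  "pd_v g p = vector_derivative (\<lambda>t. g (fst p, t)) (at (snd p))"

definition ln_sq :: "(real \<times> real \<Rightarrow> real) \<Rightarrow> real \<times> real \<Rightarrow> real" where
  "ln_sq f p = ln ((f p)\<^sup>2)"

definition mink :: "real^4 \<Rightarrow> real^4 \<Rightarrow> real" where
  "mink a b = a $ 1 * b $ 1 + a $ 2 * b $ 2 + a $ 3 * b $ 3 - a $ 4 * b $ 4"

definition pseudo_orthonormal_frame :: "real^4 \<Rightarrow> real^4 \<Rightarrow> real^4 \<Rightarrow> real^4 \<Rightarrow> bool" where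
  "pseudo_orthonormal_frame x y n1 n2 \<longleftrightarrow>
     independent {x, y, n1, n2} \<and> span {x, y, n1, n2} = UNIV \<and>
     mink x x = 0 \<and> mink y y = 0 \<and> mink x y = -1 \<and>
     mink n1 n1 = 1 \<and> mink n2 n2 = 1 \<and> mink n1 n2 = 0 \<and>
     mink x n1 = 0 \<and> mink x n2 = 0 \<and> mink y n1 = 0 \<and> mink y n2 = 0"

definition immersed_surface :: "(real \<times> real) set \<Rightarrow> (real \<times> real \<Rightarrow> real^4) \<Rightarrow> bool" where
  "immersed_surface D z \<longleftrightarrow> planar_domain D \<and> smooth_on z D \<and>
     (\<forall>p\<in>D. inj (frechet_derivative z (at p)))"

definition tangent_plane :: "(real \<times> real \<Rightarrow> real^4) \<Rightarrow> real \<times> real \<Rightarrow> (real^4) set" where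
  "tangent_plane z p = range (frechet_derivative z (at p))"

definition normal_plane :: "(real \<times> real \<Rightarrow> real^4) \<Rightarrow> real \<times> real \<Rightarrow> (real^4) set" where
  "normal_plane z p = {n. \<forall>t\<in>tangent_plane z p. mink n t = 0}"

definition timelike_surface :: "(real \<times> real) set \<Rightarrow> (real \<times> real \<Rightarrow> real^4) \<Rightarrow> bool" where
  "timelike_surface D z \<longleftrightarrow> immersed_surface D z \<and>
     (\<forall>p\<in>D. (\<exists>t\<in>tangent_plane z p. mink t t > 0) \<and> (\<exists>t\<in>tangent_plane z p. mink t t < 0))"

definition isotropic_parameters ::
  "(real \<times> real) set \<Rightarrow> (real \<times> real \<Rightarrow> real) \<Rightarrow> (real \<times> real \<Rightarrow> real^4) \<Rightarrow> bool" where
  "isotropic_parameters D f z \<longleftrightarrow>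
     (\<forall>p\<in>D. f p > 0 \<and> mink (pd_u z p) (pd_u z p) = 0 \<and> mink (pd_v z p) (pd_v z p) = 0 \<and>
            mink (pd_u z p) (pd_v z p) = - (f p)\<^sup>2)"

text \<open>Vector fields along the surface \<open>z\<close> are functions of the parameters with values in the
  ambient space. For a tangent field \<open>X\<close>, the flat connection differentiates \<open>Y\<close> in
  the direction of the parameter plane that the differential of \<open>z\<close> (injective for an immersion)
  maps to \<open>X p\<close>.\<close>

definition flat_connection ::
  "(real \<times> real \<Rightarrow> real^4) \<Rightarrow> (real \<times> real \<Rightarrow> real^4) \<Rightarrow> (real \<times> real \<Rightarrow> real^4)
     \<Rightarrow> real \<times> real \<Rightarrow> real^4" where
  "flat_connection z X Y p =
     frechet_derivative Y (at p) (inv (frechet_derivative z (at p)) (X p))"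

text \<open>Well-defined for timelike surfaces, where the tangent planes are nondegenerate.\<close>

definition normal_part :: "(real \<times> real \<Rightarrow> real^4) \<Rightarrow> real \<times> real \<Rightarrow> real^4 \<Rightarrow> real^4" where
  "normal_part z p w = (THE n. n \<in> normal_plane z p \<and> w - n \<in> tangent_plane z p)"

definition second_fund ::
  "(real \<times> real \<Rightarrow> real^4) \<Rightarrow> (real \<times> real \<Rightarrow> real^4) \<Rightarrow> (real \<times> real \<Rightarrow> real^4)
     \<Rightarrow> real \<times> real \<Rightarrow> real^4" where
  "second_fund z X Y p = normal_part z p (flat_connection z X Y p)"

text \<open>The trace is taken with respect to the induced metric, by contracting with the inverse of its
  Gram matrix with entries \<open>E, F, G\<close> in the coordinate basis.\<close>

definition mean_curvature :: "(real \<times> real \<Rightarrow> real^4) \<Rightarrow> real \<times> real \<Rightarrow> real^4" where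
  "mean_curvature z p =
     (let E = mink (pd_u z p) (pd_u z p);
          F = mink (pd_u z p) (pd_v z p);
          G = mink (pd_v z p) (pd_v z p)
      in (1 / 2) *\<^sub>R ((1 / (E * G - F\<^sup>2)) *\<^sub>R
           (G *\<^sub>R second_fund z (pd_u z) (pd_u z) p
            - F *\<^sub>R second_fund z (pd_u z) (pd_v z) p
            - F *\<^sub>R second_fund z (pd_v z) (pd_u z) p
            + E *\<^sub>R second_fund z (pd_v z) (pd_v z) p)))"

definition geo_x :: "(real \<times> real \<Rightarrow> real) \<Rightarrow> (real \<times> real \<Rightarrow> real^4) \<Rightarrow> real \<times> real \<Rightarrow> real^4" where
  "geo_x f z p = (1 / f p) *\<^sub>R pd_u z p"

definition geo_y :: "(real \<times> real \<Rightarrow> real) \<Rightarrow> (real \<times> real \<Rightarrow> real^4) \<Rightarrow> real \<times> real \<Rightarrow> real^4" where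
  "geo_y f z p = (1 / f p) *\<^sub>R pd_v z p"

definition geo_nu :: "(real \<times> real \<Rightarrow> real^4) \<Rightarrow> real \<times> real \<Rightarrow> real" where
  "geo_nu z p = sqrt (mink (mean_curvature z p) (mean_curvature z p))"

definition geo_n1 :: "(real \<times> real \<Rightarrow> real^4) \<Rightarrow> real \<times> real \<Rightarrow> real^4" where
  "geo_n1 z p = (1 / geo_nu z p) *\<^sub>R mean_curvature z p"

text \<open>The members \<open>x, y, n1\<close> of the geometric frame field are determined by the surface, so only
  \<open>n2\<close>, which is unique up to sign, appears as a parameter.\<close>

definition geometric_frame_field ::
  "(real \<times> real) set \<Rightarrow> (real \<times> real \<Rightarrow> real) \<Rightarrow> (real \<times> real \<Rightarrow> real^4)
     \<Rightarrow> (real \<times> real \<Rightarrow> real^4) \<Rightarrow> bool" where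
  "geometric_frame_field D f z n2 \<longleftrightarrow>
     timelike_surface D z \<and> isotropic_parameters D f z \<and>
     (\<forall>p\<in>D. mean_curvature z p \<noteq> 0) \<and>
     smooth_on n2 D \<and>
     (\<forall>p\<in>D. geo_n1 z p \<in> normal_plane z p \<and> n2 p \<in> normal_plane z p \<and>
            mink (geo_n1 z p) (geo_n1 z p) = 1 \<and> mink (n2 p) (n2 p) = 1 \<and>
            mink (geo_n1 z p) (n2 p) = 0)"

definition associated_functions ::
  "(real \<times> real) set \<Rightarrow> (real \<times> real \<Rightarrow> real) \<Rightarrow> (real \<times> real \<Rightarrow> real^4)
     \<Rightarrow> (real \<times> real \<Rightarrow> real^4)
     \<Rightarrow> (real \<times> real \<Rightarrow> real) \<Rightarrow> (real \<times> real \<Rightarrow> real)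
     \<Rightarrow> (real \<times> real \<Rightarrow> real) \<Rightarrow> (real \<times> real \<Rightarrow> real) \<Rightarrow> bool" where
  "associated_functions D f z n2 lam1 mu1 lam2 mu2 \<longleftrightarrow>
     (\<forall>p\<in>D. second_fund z (geo_x f z) (geo_x f z) p = lam1 p *\<^sub>R geo_n1 z p + mu1 p *\<^sub>R n2 p \<and>
            second_fund z (geo_x f z) (geo_y f z) p = - (geo_nu z p *\<^sub>R geo_n1 z p) \<and>
            second_fund z (geo_y f z) (geo_y f z) p = lam2 p *\<^sub>R geo_n1 z p + mu2 p *\<^sub>R n2 p)"

text \<open>Replacing \<open>n2\<close> by \<open>- n2\<close> only changes the signs of \<open>mu1\<close> and \<open>mu2\<close>, so being of third type
  does not depend on the choice of \<open>n2\<close>.\<close>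

definition third_type_surface ::
  "(real \<times> real) set \<Rightarrow> (real \<times> real \<Rightarrow> real) \<Rightarrow> (real \<times> real \<Rightarrow> real^4) \<Rightarrow> bool" where
  "third_type_surface D f z \<longleftrightarrow>
     (\<exists>n2 lam1 mu1 lam2 mu2.
        geometric_frame_field D f z n2 \<and>
        associated_functions D f z n2 lam1 mu1 lam2 mu2 \<and>
        (\<forall>p\<in>D. mu1 p \<noteq> 0 \<and> mu2 p = 0 \<and> lam2 p = 0))"

definition surface_with_data ::
  "(real \<times> real) set \<Rightarrow> (real \<times> real \<Rightarrow> real) \<Rightarrow> (real \<times> real \<Rightarrow> real) \<Rightarrow> (real \<times> real \<Rightarrow> real)
     \<Rightarrow> real \<times> real \<Rightarrow> real^4 \<Rightarrow> real^4 \<Rightarrow> real^4 \<Rightarrow> real^4 \<Rightarrow> real^4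
     \<Rightarrow> (real \<times> real \<Rightarrow> real^4) \<Rightarrow> bool" where
  "surface_with_data D f lam1 mu1 q p0 x0 y0 n10 n20 z \<longleftrightarrow>
     third_type_surface D f z \<and> z q = p0 \<and>
     (\<exists>n2 lam2 mu2.
        geometric_frame_field D f z n2 \<and>
        geo_x f z q = x0 \<and> geo_y f z q = y0 \<and> geo_n1 z q = n10 \<and> n2 q = n20 \<and>
        associated_functions D f z n2 lam1 mu1 lam2 mu2)"

end

theory Submission
  imports Defs
begin

text \<open>Put \<open>F = f\<^sup>2\<close>, \<open>L = (ln F)\<^sub>u\<close>, \<open>\<xi> = f x = z\<^sub>u\<close> and \<open>\<eta> = y / f = z\<^sub>v / F\<close>. The Gauss and Codazzi equations of a
  surface of third type force \<open>\<nu> = sqrt L\<^sub>v / f\<close>, the vanishing of one normal connection coefficient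
  and \<open>c = - (F \<mu>\<^sub>1)\<^sub>v / (F \<nu>)\<close> for the other one, so the frame \<open>(\<xi>, \<eta>, n\<^sub>1, n\<^sub>2)\<close> of every such surface solves
  one and the same linear first order system. Its coefficients are skew for the scalar products of
  a null frame, which makes a tensor built from two solutions constant; this gives both the
  preservation of the frame relations and uniqueness.

  For existence, \<open>s = L / \<nu>\<close> satisfies \<open>s\<^sub>v = F \<nu>\<close>, and conditions (i)-(iii) say exactly that
  \<open>\<eta>\<close>, \<open>n\<^sub>1 + s \<eta>\<close>, \<open>\<xi> + s n\<^sub>1 + s\<^sup>2/2 \<eta>\<close>, \<open>n\<^sub>2\<close> and \<open>z - (s/\<nu>) \<eta>\<close> may be taken independent of \<open>v\<close> and solving a
  linear system of ordinary differential equations in \<open>u\<close>.\<close>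

section \<open>Smooth maps and partial derivatives\<close>

text \<open>The overdetermined frame equations in two variables are integrated without a Frobenius
  theorem. With the scaling \<open>\<eta> = y / f\<close> the condition \<sigma>(y,y) = 0 becomes
  \<eta>_v = 0, and the v-derivatives form a chain: \<xi> goes to n1, n1 goes to \<eta>, both with
  the factor -F \<nu>, and \<eta> and n2 go to 0. In a variable \<open>s\<close> with s_v = F \<nu>
  this is a nilpotent system with constant coefficients, so its flow is polynomial of degree 2 in
  \<open>s\<close>; undoing that flow produces the v-constant fields. A function of u may still be
  added to \<open>s\<close>. The value L / \<nu> is admissible because L_v = F \<nu>^2 and \<nu>_v =
  0, and it is chosen because L = \<nu> s absorbs every term with \<open>L\<close> in the
  u-equations, for instance \<eta>_u = -\<nu> M. Dividing once more, (s / \<nu>)_v = F, so (s /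
  \<nu>) \<eta> is a v-primitive of z_v = F \<eta>. What remains is one linear equation in u along v
  = v0. Its solution does not depend on v, so smooth dependence on parameters never enters. The new
  domain is a square: the solution in u is local, and v-constancy is used along vertical
  segments.\<close>

lemma ck_on_cong:
  fixes g g' :: "'a::real_normed_vector \<Rightarrow> 'b::real_normed_vector"
  assumes "open S" and "\<And>p. p \<in> S \<Longrightarrow> g p = g' p" and "ck_on k g S"
  shows "ck_on k g' S"
  using assms(2,3)
proof (induction k arbitrary: g g')
  case 0
  then show ?case using continuous_on_eq by fastforce
next
  case (Suc k)
  have g': "(g' has_derivative frechet_derivative g (at p)) (at p)" if "p \<in> S" for p
  proof -
    have "(g has_derivative frechet_derivative g (at p)) (at p)"
      using Suc.prems(2) that by (simp add: frechet_derivative_works[symmetric])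
    then show ?thesis
      using has_derivative_transform_within_open[OF _ \<open>open S\<close> that] Suc.prems(1) by blast
  qed
  have "ck_on k (\<lambda>p. frechet_derivative g' (at p) h) S" for h
  proof (rule Suc.IH)
    show "ck_on k (\<lambda>p. frechet_derivative g (at p) h) S"
      using Suc.prems(2) by simp
  qed (use frechet_derivative_at[OF g'] in simp)
  then show ?case using g' by (auto simp: differentiable_def)
qed

text \<open>On an open set any supplied derivative coincides with the one selected by
  \<open>frechet_derivative\<close>, so regularity can be shown on explicit derivative
  formulas.\<close>

lemma ck_on_SucI:
  fixes g :: "'a::real_normed_vector \<Rightarrow> 'b::real_normed_vector"
  assumes "open S" and "\<And>p. p \<in> S \<Longrightarrow> (g has_derivative g' p) (at p)"
    and "\<And>h. ck_on k (\<lambda>p. g' p h) S"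
  shows "ck_on (Suc k) g S"
proof -
  have "frechet_derivative g (at p) = g' p" if "p \<in> S" for p
    using frechet_derivative_at[OF assms(2)[OF that]] by simp
  then have "ck_on k (\<lambda>p. frechet_derivative g (at p) h) S" for h
    by (intro ck_on_cong[OF assms(1) _ assms(3)[of h]]) simp
  then show ?thesis using assms(2) by (auto simp: differentiable_def)
qed

lemma ck_on_has_derivative:
  assumes "ck_on (Suc k) g S" "p \<in> S"
  shows "(g has_derivative frechet_derivative g (at p)) (at p)"
  using assms by (simp add: frechet_derivative_works[symmetric])

lemma ck_on_frechet:
  assumes "ck_on (Suc k) g S"
  shows "ck_on k (\<lambda>p. frechet_derivative g (at p) h) S"
  using assms by simp

text \<open>Order \<open>Suc k\<close> speaks of differentiability and of the derivatives only.
  Lower order of the map itself follows by induction, starting from continuity of differentiable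
  maps. Product rules need it, because undifferentiated factors occur in them.\<close>

lemma ck_on_SucD:
  assumes "ck_on (Suc k) g S"
  shows "ck_on k g S"
  using assms
proof (induction k arbitrary: g)
  case 0
  then show ?case
    by (auto intro!: continuous_at_imp_continuous_on differentiable_imp_continuous_within)
next
  case (Suc k)
  have "ck_on k (\<lambda>p. frechet_derivative g (at p) h) S" for h
    using Suc.prems by (intro Suc.IH ck_on_frechet)
  then show ?case using Suc.prems by simp
qed

section \<open>Closure properties of maps of class \<open>ck_on\<close>\<close>

lemma ck_on_const: "open S \<Longrightarrow> ck_on k (\<lambda>p. c) S"
  by (induction k arbitrary: c) (auto intro!: ck_on_SucI has_derivative_const simp del: ck_on.simps(2))

lemma ck_on_add:
  assumes "open S" "ck_on k f S" "ck_on k g S"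
  shows "ck_on k (\<lambda>p. f p + g p) S"
  using assms(2,3)
proof (induction k arbitrary: f g)
  case 0
  then show ?case by (auto intro: continuous_intros)
next
  case (Suc k)
  show ?case
    using ck_on_has_derivative[OF Suc.prems(1)] ck_on_has_derivative[OF Suc.prems(2)]
      ck_on_frechet[OF Suc.prems(1)] ck_on_frechet[OF Suc.prems(2)]
    by (auto intro!: ck_on_SucI[OF \<open>open S\<close>] Suc.IH has_derivative_add simp del: ck_on.simps)
qed

lemma (in bounded_linear) ck_on:
  assumes "open S" "ck_on k g S"
  shows "ck_on k (\<lambda>p. f (g p)) S"
  using assms(2)
proof (induction k arbitrary: g)
  case 0
  then show ?case by (auto intro: continuous_on)
next
  case (Suc k)
  show ?case
    using ck_on_has_derivative[OF Suc.prems] ck_on_frechet[OF Suc.prems]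
    by (auto intro!: ck_on_SucI[OF \<open>open S\<close>] Suc.IH has_derivative simp del: ck_on.simps)
qed

text \<open>One product rule serves real multiplication, scaling of vectors and the Minkowski
  product.\<close>

lemma (in bounded_bilinear) ck_on:
  assumes "open S" "ck_on k f S" "ck_on k g S"
  shows "ck_on k (\<lambda>p. prod (f p) (g p)) S"
  using assms(2,3)
proof (induction k arbitrary: f g)
  case 0
  then show ?case by (auto intro: continuous_on)
next
  case (Suc k)
  show ?case
  proof (rule ck_on_SucI[OF \<open>open S\<close>])
    show "((\<lambda>p. prod (f p) (g p)) has_derivative
       (\<lambda>h. prod (f p) (frechet_derivative g (at p) h) + prod (frechet_derivative f (at p) h) (g p))) (at p)"
      if "p \<in> S" for p
      using ck_on_has_derivative[OF Suc.prems(1) that] ck_on_has_derivative[OF Suc.prems(2) that]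
      by (rule FDERIV)
    show "ck_on k (\<lambda>p. prod (f p) (frechet_derivative g (at p) h)
        + prod (frechet_derivative f (at p) h) (g p)) S" for h
      by (intro ck_on_add Suc.IH ck_on_frechet ck_on_SucD[OF Suc.prems(1)] ck_on_SucD[OF Suc.prems(2)]
        Suc.prems \<open>open S\<close>)
  qed
qed

lemma ck_on_inverse:
  fixes g :: "'a::real_normed_vector \<Rightarrow> real"
  assumes "open S" "ck_on k g S" and nz: "\<And>p. p \<in> S \<Longrightarrow> g p \<noteq> 0"
  shows "ck_on k (\<lambda>p. inverse (g p)) S"
  using assms(2)
proof (induction k)
  case 0
  then show ?case using nz by (auto intro!: continuous_on_inverse)
next
  case (Suc k)
  show ?case
  proof (rule ck_on_SucI[OF \<open>open S\<close>])
    show "((\<lambda>p. inverse (g p)) has_derivative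
       (\<lambda>h. - 1 * (inverse (g p) * frechet_derivative g (at p) h * inverse (g p)))) (at p)"
      if "p \<in> S" for p
      using Deriv.has_derivative_inverse[OF nz[OF that] ck_on_has_derivative[OF Suc.prems that]]
      by simp
    show "ck_on k (\<lambda>p. - 1 * (inverse (g p) * frechet_derivative g (at p) h * inverse (g p))) S" for h
      by (intro bounded_bilinear.ck_on[OF bounded_bilinear_mult] ck_on_const ck_on_frechet
        Suc.prems ck_on_SucD[OF Suc.prems] Suc.IH \<open>open S\<close>)
  qed
qed

lemma ck_on_sqrt:
  fixes g :: "'a::real_normed_vector \<Rightarrow> real"
  assumes "open S" "ck_on k g S" and pos: "\<And>p. p \<in> S \<Longrightarrow> g p > 0"
  shows "ck_on k (\<lambda>p. sqrt (g p)) S"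
  using assms(2)
proof (induction k)
  case 0
  then show ?case by (auto intro: continuous_intros)
next
  case (Suc k)
  show ?case
  proof (rule ck_on_SucI[OF \<open>open S\<close>])
    show "((\<lambda>p. sqrt (g p)) has_derivative
       (\<lambda>h. frechet_derivative g (at p) h * ((1/2) * inverse (sqrt (g p))))) (at p)"
      if "p \<in> S" for p
      using has_derivative_compose[OF ck_on_has_derivative[OF Suc.prems that]
          DERIV_real_sqrt[OF pos[OF that], THEN has_field_derivative_imp_has_derivative]]
      by (simp add: algebra_simps)
    show "ck_on k (\<lambda>p. frechet_derivative g (at p) h * ((1/2) * inverse (sqrt (g p)))) S" for h
      by (intro bounded_bilinear.ck_on[OF bounded_bilinear_mult] ck_on_const ck_on_frechet
        ck_on_inverse Suc.prems ck_on_SucD[OF Suc.prems] Suc.IH \<open>open S\<close>) (use pos in force)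
  qed
qed

text \<open>No induction: the derivative g' / g contains no logarithm, so everything reduces to
  \<open>ck_on_inverse\<close>.\<close>

lemma ck_on_ln:
  fixes g :: "'a::real_normed_vector \<Rightarrow> real"
  assumes "open S" "ck_on k g S" and pos: "\<And>p. p \<in> S \<Longrightarrow> g p > 0"
  shows "ck_on k (\<lambda>p. ln (g p)) S"
proof (cases k)
  case 0
  then show ?thesis using assms(2) pos by (force intro!: continuous_intros)
next
  case (Suc k)
  note g = assms(2)[unfolded Suc]
  show ?thesis unfolding Suc
  proof (rule ck_on_SucI[OF \<open>open S\<close>])
    show "((\<lambda>p. ln (g p)) has_derivative
       (\<lambda>h. frechet_derivative g (at p) h * inverse (g p))) (at p)"
      if "p \<in> S" for p
      using has_derivative_compose[OF ck_on_has_derivative[OF g that]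
          DERIV_ln[OF pos[OF that], THEN has_field_derivative_imp_has_derivative]]
      by (simp add: algebra_simps)
    show "ck_on k (\<lambda>p. frechet_derivative g (at p) h * inverse (g p)) S" for h
      by (intro bounded_bilinear.ck_on[OF bounded_bilinear_mult] ck_on_const ck_on_frechet ck_on_SucD[OF g]
        ck_on_inverse g \<open>open S\<close>) (use pos in force)
  qed
qed

lemma ck_on_subset: "ck_on k g S \<Longrightarrow> T \<subseteq> S \<Longrightarrow> ck_on k g T"
  by (induction k arbitrary: g) (auto intro: continuous_on_subset)

lemma smooth_on_subset: "smooth_on g S \<Longrightarrow> T \<subseteq> S \<Longrightarrow> smooth_on g T"
  by (auto simp: smooth_on_def intro: ck_on_subset)

lemma smooth_on_cong:
  fixes g g' :: "'a::real_normed_vector \<Rightarrow> 'b::real_normed_vector"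
  assumes "smooth_on g S" "open S" "\<And>p. p \<in> S \<Longrightarrow> g p = g' p"
  shows "smooth_on g' S"
  using assms ck_on_cong unfolding smooth_on_def by blast

lemma smooth_on_const: "open S \<Longrightarrow> smooth_on (\<lambda>p. c) S"
  by (simp add: smooth_on_def ck_on_const)

lemma smooth_on_add: "open S \<Longrightarrow> smooth_on f S \<Longrightarrow> smooth_on g S \<Longrightarrow> smooth_on (\<lambda>p. f p + g p) S"
  by (simp add: smooth_on_def ck_on_add)

lemma smooth_on_minus: "open S \<Longrightarrow> smooth_on f S \<Longrightarrow> smooth_on (\<lambda>p. - f p) S"
  by (simp add: smooth_on_def bounded_linear.ck_on[OF bounded_linear_minus[OF bounded_linear_ident]])

lemma smooth_on_diff: "open S \<Longrightarrow> smooth_on f S \<Longrightarrow> smooth_on g S \<Longrightarrow> smooth_on (\<lambda>p. f p - g p) S"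
  using smooth_on_add[of S f "\<lambda>p. - g p"] smooth_on_minus[of S g] by simp

lemma smooth_on_mult:
  fixes f g :: "'a::real_normed_vector \<Rightarrow> real"
  shows "open S \<Longrightarrow> smooth_on f S \<Longrightarrow> smooth_on g S \<Longrightarrow> smooth_on (\<lambda>p. f p * g p) S"
  by (simp add: smooth_on_def bounded_bilinear.ck_on[OF bounded_bilinear_mult])

lemma smooth_on_scaleR:
  "open S \<Longrightarrow> smooth_on f S \<Longrightarrow> smooth_on g S \<Longrightarrow> smooth_on (\<lambda>p. f p *\<^sub>R g p) S"
  by (simp add: smooth_on_def bounded_bilinear.ck_on[OF bounded_bilinear_scaleR])

lemma smooth_on_divide:
  fixes f g :: "'a::real_normed_vector \<Rightarrow> real"
  shows "open S \<Longrightarrow> smooth_on f S \<Longrightarrow> smooth_on g S \<Longrightarrow> (\<And>p. p \<in> S \<Longrightarrow> g p \<noteq> 0) \<Longrightarrow>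
    smooth_on (\<lambda>p. f p / g p) S"
  by (simp add: smooth_on_def divide_inverse bounded_bilinear.ck_on[OF bounded_bilinear_mult] ck_on_inverse)

lemma smooth_on_power2:
  fixes f :: "'a::real_normed_vector \<Rightarrow> real"
  shows "open S \<Longrightarrow> smooth_on f S \<Longrightarrow> smooth_on (\<lambda>p. (f p)\<^sup>2) S"
  by (simp add: power2_eq_square smooth_on_mult)

lemma smooth_on_sqrt:
  fixes f :: "'a::real_normed_vector \<Rightarrow> real"
  shows "open S \<Longrightarrow> smooth_on f S \<Longrightarrow> (\<And>p. p \<in> S \<Longrightarrow> f p > 0) \<Longrightarrow> smooth_on (\<lambda>p. sqrt (f p)) S"
  by (simp add: smooth_on_def ck_on_sqrt)

lemma bounded_bilinear_mink: "bounded_bilinear mink"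
proof -
  have "bilinear mink"
    by (auto simp: bilinear_def mink_def algebra_simps intro!: linearI)
  then show ?thesis by (simp add: bilinear_conv_bounded_bilinear)
qed

interpretation mink: bounded_bilinear mink by (rule bounded_bilinear_mink)

lemma mink_commute: "mink a b = mink b a"
  by (simp add: mink_def)

lemma smooth_on_mink:
  "open S \<Longrightarrow> smooth_on f S \<Longrightarrow> smooth_on g S \<Longrightarrow> smooth_on (\<lambda>p. mink (f p) (g p)) S"
  by (simp add: smooth_on_def mink.ck_on)

lemmas smooth_intros = smooth_on_const smooth_on_add smooth_on_minus smooth_on_diff smooth_on_mult
  smooth_on_scaleR smooth_on_divide smooth_on_power2 smooth_on_sqrt smooth_on_mink

text \<open>This is total differentiability, with the derivative recorded through its two partials.
  Chain and product rules thus remain available, while both partials are computed by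
  resolution.\<close>

definition has_pd ::
  "(real \<times> real \<Rightarrow> 'a::real_normed_vector) \<Rightarrow> 'a \<Rightarrow> 'a \<Rightarrow> real \<times> real \<Rightarrow> bool" where
  "has_pd g gu gv p \<longleftrightarrow> (g has_derivative (\<lambda>h. fst h *\<^sub>R gu + snd h *\<^sub>R gv)) (at p)"

lemma has_pd_vector_derivative:
  assumes "has_pd g gu gv p"
  shows "((\<lambda>t. g (t, snd p)) has_vector_derivative gu) (at (fst p))"
    and "((\<lambda>t. g (fst p, t)) has_vector_derivative gv) (at (snd p))"
proof -
  have g: "(g has_derivative (\<lambda>h. fst h *\<^sub>R gu + snd h *\<^sub>R gv)) (at (fst p, snd p))"
    using assms by (simp add: has_pd_def)
  have "((\<lambda>t. (t, snd p)) has_derivative (\<lambda>h. (h, 0))) (at (fst p))"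
    by (auto intro!: derivative_eq_intros)
  from has_derivative_compose[OF this g]
  show "((\<lambda>t. g (t, snd p)) has_vector_derivative gu) (at (fst p))"
    by (simp add: has_vector_derivative_def)
  have "((\<lambda>t. (fst p, t)) has_derivative (\<lambda>h. (0, h))) (at (snd p))"
    by (auto intro!: derivative_eq_intros)
  from has_derivative_compose[OF this g]
  show "((\<lambda>t. g (fst p, t)) has_vector_derivative gv) (at (snd p))"
    by (simp add: has_vector_derivative_def)
qed

lemma has_pd_unique:
  assumes "has_pd g gu gv p"
  shows "pd_u g p = gu" "pd_v g p = gv"
  using has_pd_vector_derivative[OF assms] by (simp_all add: pd_u_def pd_v_def vector_derivative_at)

lemma has_pd_frechet:
  "has_pd g gu gv p \<Longrightarrow> frechet_derivative g (at p) = (\<lambda>h. fst h *\<^sub>R gu + snd h *\<^sub>R gv)"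
  using frechet_derivative_at unfolding has_pd_def by metis

lemma has_derivative_imp_has_pd:
  assumes "(g has_derivative g') (at p)"
  shows "has_pd g (g' (1, 0)) (g' (0, 1)) p"
proof -
  interpret bounded_linear g' by (rule has_derivative_bounded_linear[OF assms])
  have "g' h = fst h *\<^sub>R g' (1, 0) + snd h *\<^sub>R g' (0, 1)" for h
    by (simp add: scaleR[symmetric] add[symmetric])
  then have "g' = (\<lambda>h. fst h *\<^sub>R g' (1, 0) + snd h *\<^sub>R g' (0, 1))" by blast
  then show ?thesis using assms by (simp add: has_pd_def)
qed

lemma has_pd_cong:
  assumes "has_pd g gu gv p" "open S" "p \<in> S" "\<And>q. q \<in> S \<Longrightarrow> g q = g' q"
  shows "has_pd g' gu gv p"
  using assms has_derivative_transform_within_open unfolding has_pd_def by blast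

lemma smooth_on_differentiable:
  assumes "smooth_on g S" "p \<in> S"
  shows "g differentiable at p"
  using assms ck_on.simps(2)[of 0 g S] unfolding smooth_on_def by blast

lemma smooth_on_has_pd:
  assumes "smooth_on g S" "p \<in> S"
  shows "has_pd g (pd_u g p) (pd_v g p) p"
proof -
  have "(g has_derivative frechet_derivative g (at p)) (at p)"
    using smooth_on_differentiable[OF assms] by (simp add: frechet_derivative_works)
  from has_derivative_imp_has_pd[OF this] show ?thesis
    using has_pd_unique by metis
qed

lemma smooth_on_continuous: "smooth_on g S \<Longrightarrow> continuous_on S g"
  using ck_on.simps(1) unfolding smooth_on_def by blast

lemma smooth_on_frechet: "smooth_on g S \<Longrightarrow> smooth_on (\<lambda>p. frechet_derivative g (at p) h) S"
  unfolding smooth_on_def using ck_on.simps(2) by blast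

lemma smooth_on_pd:
  assumes "open S" "smooth_on g S"
  shows smooth_on_pd_u: "smooth_on (pd_u g) S" and smooth_on_pd_v: "smooth_on (pd_v g) S"
proof -
  have fr: "frechet_derivative g (at p) = (\<lambda>h. fst h *\<^sub>R pd_u g p + snd h *\<^sub>R pd_v g p)" if "p \<in> S" for p
    by (rule has_pd_frechet[OF smooth_on_has_pd[OF assms(2) that]])
  show "smooth_on (pd_u g) S"
    by (rule smooth_on_cong[OF smooth_on_frechet[OF assms(2), of "(1,0)"] assms(1)]) (simp add: fr)
  show "smooth_on (pd_v g) S"
    by (rule smooth_on_cong[OF smooth_on_frechet[OF assms(2), of "(0,1)"] assms(1)]) (simp add: fr)
qed

section \<open>Rules for computing partial derivatives\<close>

lemma has_pd_const: "has_pd (\<lambda>p. c) 0 0 p"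
  by (simp add: has_pd_def)

lemma has_pd_add:
  "has_pd f fu fv p \<Longrightarrow> has_pd g gu gv p \<Longrightarrow> has_pd (\<lambda>p. f p + g p) (fu + gu) (fv + gv) p"
  unfolding has_pd_def by (rule has_derivative_eq_rhs, rule has_derivative_add, assumption+) (auto simp: algebra_simps)

lemma has_pd_minus: "has_pd f fu fv p \<Longrightarrow> has_pd (\<lambda>p. - f p) (- fu) (- fv) p"
  unfolding has_pd_def by (rule has_derivative_eq_rhs[OF has_derivative_minus]) (auto simp: algebra_simps)

lemma has_pd_diff:
  "has_pd f fu fv p \<Longrightarrow> has_pd g gu gv p \<Longrightarrow> has_pd (\<lambda>p. f p - g p) (fu - gu) (fv - gv) p"
  unfolding has_pd_def by (rule has_derivative_eq_rhs, rule has_derivative_diff, assumption+) (auto simp: algebra_simps)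

lemma (in bounded_bilinear) has_pd:
  assumes "has_pd f fu fv p" "has_pd g gu gv p"
  shows "has_pd (\<lambda>p. prod (f p) (g p)) (prod (f p) gu + prod fu (g p)) (prod (f p) gv + prod fv (g p)) p"
  using assms unfolding has_pd_def
  by (auto intro!: has_derivative_eq_rhs[OF FDERIV] simp: algebra_simps add_left add_right scaleR_left scaleR_right)

lemmas has_pd_mult = bounded_bilinear.has_pd[OF bounded_bilinear_mult]
lemmas has_pd_scaleR = bounded_bilinear.has_pd[OF bounded_bilinear_scaleR]

lemma has_pd_compose:
  assumes "has_pd g gu gv p" "(\<phi> has_real_derivative d) (at (g p))"
  shows "has_pd (\<lambda>p. \<phi> (g p)) (d * gu) (d * gv) p"
  using has_derivative_compose[OF assms(1)[unfolded has_pd_def]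
      assms(2)[THEN has_field_derivative_imp_has_derivative]]
  unfolding has_pd_def by (simp add: algebra_simps)

lemma has_pd_divide:
  fixes f g :: "real \<times> real \<Rightarrow> real"
  assumes "has_pd f fu fv p" "has_pd g gu gv p" "g p \<noteq> 0"
  shows "has_pd (\<lambda>p. f p / g p) ((fu * g p - f p * gu) / (g p)\<^sup>2) ((fv * g p - f p * gv) / (g p)\<^sup>2) p"
proof -
  have "has_pd (\<lambda>p. f p * inverse (g p))
      (f p * (- (inverse (g p) ^ Suc (Suc 0)) * gu) + fu * inverse (g p))
      (f p * (- (inverse (g p) ^ Suc (Suc 0)) * gv) + fv * inverse (g p)) p"
    by (intro has_pd_mult has_pd_compose DERIV_inverse assms)
  then show ?thesis
    using assms(3) by (simp add: field_simps power2_eq_square)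
qed

lemma has_pd_power2:
  fixes f :: "real \<times> real \<Rightarrow> real"
  shows "has_pd f fu fv p \<Longrightarrow> has_pd (\<lambda>p. (f p)\<^sup>2) (2 * f p * fu) (2 * f p * fv) p"
  using has_pd_mult[of f fu fv p f fu fv] by (simp add: power2_eq_square algebra_simps)

text \<open>Applied first, it leaves the two partials as unknowns for the computation rules; they
  are compared with the claimed values only at the end.\<close>

lemma has_pd_eq_rhs: "has_pd g gu gv p \<Longrightarrow> gu = gu' \<Longrightarrow> gv = gv' \<Longrightarrow> has_pd g gu' gv' p"
  by simp

lemmas pd_intros = has_pd_const has_pd_add has_pd_minus has_pd_diff has_pd_mult has_pd_scaleR
  has_pd_divide has_pd_power2 mink.has_pd

text \<open>Both iterated derivatives are read off from
  \<open>g (u, v) = g (a, v) + \<integral>\<^sub>a\<^sup>u g\<^sub>u (t, v) dt\<close> by differentiating under the integral in \<open>v\<close>.\<close>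

lemma pd_commute:
  fixes g :: "real \<times> real \<Rightarrow> 'a::banach"
  assumes "open S" "smooth_on g S" "p \<in> S"
  shows "pd_u (pd_v g) p = pd_v (pd_u g) p"
proof -
  define gu gv guv gvu where "gu = pd_u g" and "gv = pd_v g" and "guv = pd_v gu" and "gvu = pd_u gv"
  note defs = gu_def gv_def guv_def gvu_def
  have sm: "smooth_on gu S" "smooth_on gv S" "smooth_on guv S"
    unfolding defs by (intro smooth_on_pd assms)+
  have pd: "has_pd g (gu q) (gv q) q" "has_pd gu (pd_u gu q) (guv q) q" "has_pd gv (gvu q) (pd_v gv q) q"
    if "q \<in> S" for q
    unfolding defs
    by (rule smooth_on_has_pd[OF assms(2) that]
        smooth_on_has_pd[OF smooth_on_pd_u[OF assms(1,2)] that]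
        smooth_on_has_pd[OF smooth_on_pd_v[OF assms(1,2)] that])+
  obtain a b where "p \<in> box a b" "cbox a b \<subseteq> S"
    using open_contains_cbox[THEN iffD1] assms(1,3) by metis
  obtain a1 a2 b1 b2 where ab: "a = (a1, a2)" "b = (b1, b2)" by (metis surj_pair)
  obtain u v where p: "p = (u, v)" by (metis surj_pair)
  have uv: "a1 < u" "u < b1" "a2 < v" "v < b2"
    using \<open>p \<in> box a b\<close> by (auto simp: ab p mem_box Basis_prod_def)
  have in_S: "(s, t) \<in> S" if "s \<in> {a1..b1}" "t \<in> {a2..b2}" for s t
    using \<open>cbox a b \<subseteq> S\<close> that by (auto simp: ab cbox_Pair_eq)
  have du: "((\<lambda>s. g (s, t)) has_vector_derivative gu (s, t)) (at s)"
    "((\<lambda>s. gv (s, t)) has_vector_derivative gvu (s, t)) (at s)"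
    if "s \<in> {a1..b1}" "t \<in> {a2..b2}" for s t
    using has_pd_vector_derivative(1)[OF pd(1)[OF in_S[OF that]]]
      has_pd_vector_derivative(1)[OF pd(3)[OF in_S[OF that]]] by simp_all
  have dv: "((\<lambda>t. g (s, t)) has_vector_derivative gv (s, t)) (at t)"
    "((\<lambda>t. gu (s, t)) has_vector_derivative guv (s, t)) (at t)"
    if "s \<in> {a1..b1}" "t \<in> {a2..b2}" for s t
    using has_pd_vector_derivative(2)[OF pd(1)[OF in_S[OF that]]]
      has_pd_vector_derivative(2)[OF pd(2)[OF in_S[OF that]]] by simp_all
  have ftc: "(((\<lambda>s. gu (s, t)) has_integral (g (s, t) - g (a1, t))) {a1..s})"
    if "s \<in> {a1..b1}" "t \<in> {a2..b2}" for s t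
    using that by (intro fundamental_theorem_of_calculus)
      (auto intro!: has_vector_derivative_at_within[OF du(1)])
  have cont: "continuous_on ({a2..b2} \<times> cbox a1 s) (\<lambda>(t, s). guv (s, t))" if "s \<in> {a1..b1}" for s
  proof -
    have "continuous_on ({a2..b2} \<times> cbox a1 s) (\<lambda>q. (snd q, fst q))"
      by (intro continuous_intros)
    moreover have "(\<lambda>q. (snd q, fst q)) ` ({a2..b2} \<times> cbox a1 s) \<subseteq> S"
      using that in_S by fastforce
    ultimately have "continuous_on ({a2..b2} \<times> cbox a1 s) (\<lambda>q. guv (snd q, fst q))"
      by (rule continuous_on_compose2[OF smooth_on_continuous[OF sm(3)]])
    then show ?thesis by (simp add: case_prod_beta')
  qed
  have eq: "gv (s, v) = gv (a1, v) + integral {a1..s} (\<lambda>r. guv (r, v))" if s: "s \<in> {a1..b1}" for s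
  proof -
    have "((\<lambda>t. integral (cbox a1 s) (\<lambda>r. gu (r, t))) has_vector_derivative
        integral (cbox a1 s) (\<lambda>r. guv (r, v))) (at v within {a2..b2})"
    proof (rule leibniz_rule_vector_derivative[OF _ _ cont[OF s]])
      show "((\<lambda>t. gu (r, t)) has_vector_derivative guv (r, t)) (at t within {a2..b2})"
        if "t \<in> {a2..b2}" "r \<in> cbox a1 s" for t r
        using that s by (intro has_vector_derivative_at_within[OF dv(2)]) auto
      show "(\<lambda>r. gu (r, t)) integrable_on cbox a1 s" if "t \<in> {a2..b2}" for t
        using ftc[OF s that] by (auto simp: integrable_on_def)
    qed (use uv in auto)
    then have "((\<lambda>t. g (a1, t) + integral {a1..s} (\<lambda>r. gu (r, t))) has_vector_derivative
        gv (a1, v) + integral {a1..s} (\<lambda>r. guv (r, v))) (at v within {a2..b2})"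
      using uv by (intro has_vector_derivative_add has_vector_derivative_at_within[OF dv(1)]) auto
    moreover have "g (s, t) = g (a1, t) + integral {a1..s} (\<lambda>r. gu (r, t))" if "t \<in> {a2..b2}" for t
      using integral_unique[OF ftc[OF s that]] by simp
    ultimately have "((\<lambda>t. g (s, t)) has_vector_derivative
        gv (a1, v) + integral {a1..s} (\<lambda>r. guv (r, v))) (at v within cbox a2 b2)"
      unfolding cbox_interval
      by - (rule has_vector_derivative_transform[rotated 2], assumption, use uv in auto)
    moreover have "((\<lambda>t. g (s, t)) has_vector_derivative gv (s, v)) (at v within cbox a2 b2)"
      using s uv by (intro has_vector_derivative_at_within[OF dv(1)]) auto
    ultimately show ?thesis
      using uv by (intro vector_derivative_unique_within_closed_interval[of a2 b2 v]) auto
  qed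
  have "continuous_on {a1..b1} (\<lambda>r. guv (r, v))"
    using uv in_S
    by (intro continuous_on_compose2[OF smooth_on_continuous[OF sm(3)], where f = "\<lambda>r. (r, v)"]
        continuous_on_Pair continuous_on_id continuous_on_const) auto
  from integral_has_vector_derivative[OF this, of u]
  have "((\<lambda>s. gv (a1, v) + integral {a1..s} (\<lambda>r. guv (r, v))) has_vector_derivative guv (u, v))
      (at u within {a1..b1})"
    using uv has_vector_derivative_add[OF has_vector_derivative_const, of _ "guv (u, v)"] by auto
  then have "((\<lambda>s. gv (s, v)) has_vector_derivative guv (u, v)) (at u within cbox a1 b1)"
    unfolding cbox_interval
    by - (rule has_vector_derivative_transform[rotated], erule eq, assumption, use uv in simp)
  moreover have "((\<lambda>s. gv (s, v)) has_vector_derivative gvu (u, v)) (at u within cbox a1 b1)"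
    using uv by (intro has_vector_derivative_at_within[OF du(2)]) auto
  ultimately have "gvu (u, v) = guv (u, v)"
    using uv by (intro vector_derivative_unique_within_closed_interval[of a1 b1 u]) auto
  then show ?thesis unfolding defs p .
qed

section \<open>Local solutions of ordinary differential equations\<close>

text \<open>Banach's fixed point theorem for the integral operator. The Lipschitz bound holds on the
  whole space, as for linear equations, so no ball has to be kept invariant and the length of the
  interval depends only on \<open>K\<close> and on the distance of \<open>t0\<close> to the
  ends.\<close>

lemma picard_local:
  fixes F :: "real \<Rightarrow> 'a::banach \<Rightarrow> 'a"
  assumes t0: "a < t0" "t0 < b"
    and cont: "continuous_on ({a..b} \<times> UNIV) (\<lambda>(t, x). F t x)"
    and lip: "\<And>t x y. t \<in> {a..b} \<Longrightarrow> norm (F t x - F t y) \<le> K * norm (x - y)"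
  obtains d \<phi> where "d > 0" "{t0 - d..t0 + d} \<subseteq> {a..b}" "\<phi> t0 = x0"
    "\<And>t. t \<in> {t0 - d<..<t0 + d} \<Longrightarrow> (\<phi> has_vector_derivative F t (\<phi> t)) (at t)"
proof -
  \<comment> \<open>The last entry gives 4 d |K| < 1. The factor 4 arises because the operator
    contains two integrals, each over a length of at most 2 d.\<close>
  define d where "d = min (min (t0 - a) (b - t0)) (1 / (8 * (\<bar>K\<bar> + 1)))"
  have d: "d > 0" "d \<le> t0 - a" "d \<le> b - t0"
    using t0 by (auto simp: d_def)
  have "4 * d * \<bar>K\<bar> \<le> 4 * (1 / (8 * (\<bar>K\<bar> + 1))) * \<bar>K\<bar>"
    by (intro mult_right_mono mult_left_mono) (auto simp: d_def)
  also have "\<dots> < 1" by (simp add: field_simps)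
  finally have contr: "4 * d * \<bar>K\<bar> < 1" .
  define l r where "l = t0 - d" and "r = t0 + d"
  have lr: "l < t0" "t0 < r" "r - l = 2 * d" "{l..r} \<subseteq> {a..b}"
    using d by (auto simp: l_def r_def)
  \<comment> \<open>Clamping to {l..r} makes the operator act on bounded continuous functions on the
    whole line, a complete space.\<close>
  define cl where "cl t = max l (min r t)" for t
  have cl: "cl t \<in> {l..r}" for t using lr by (auto simp: cl_def)
  have cont_comp: "continuous_on {l..r} (\<lambda>s. F s (g s))" if "continuous_on {l..r} g" for g
  proof -
    have "continuous_on {l..r} (\<lambda>s. (s, g s))"
      using that by (intro continuous_intros)
    moreover have "(\<lambda>s. (s, g s)) ` {l..r} \<subseteq> {a..b} \<times> UNIV"
      using lr(4) by blast
    ultimately show ?thesis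
      using continuous_on_compose2[OF cont] by fastforce
  qed
  have cont_app: "continuous_on {l..r} (\<lambda>s. F s (apply_bcontfun \<phi> s))" for \<phi>
    by (rule cont_comp) simp
  \<comment> \<open>The integral from \<open>t0\<close> to t is written as a difference of two
    integrals starting at \<open>l\<close>, which treats t < t0 and t > t0 alike.\<close>
  define G where "G \<phi> t = x0 + integral {l..cl t} (\<lambda>s. F s (apply_bcontfun \<phi> s))
      - integral {l..t0} (\<lambda>s. F s (apply_bcontfun \<phi> s))" for \<phi> t
  have G_bcontfun: "G \<phi> \<in> bcontfun" for \<phi>
  proof -
    let ?I = "\<lambda>t. x0 + integral {l..t} (\<lambda>s. F s (apply_bcontfun \<phi> s))
      - integral {l..t0} (\<lambda>s. F s (apply_bcontfun \<phi> s))"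
    have I: "continuous_on {l..r} ?I"
      by (intro continuous_intros indefinite_integral_continuous_1 integrable_continuous_real cont_app)
    have "bounded (?I ` {l..r})"
      by (intro compact_imp_bounded compact_continuous_image I compact_Icc)
    then obtain B where B: "norm (?I t) \<le> B" if "t \<in> {l..r}" for t
      unfolding bounded_iff by blast
    have "continuous_on UNIV cl" unfolding cl_def by (intro continuous_intros)
    then have "continuous_on UNIV (\<lambda>t. ?I (cl t))"
      by (rule continuous_on_compose2[OF I]) (use cl in auto)
    then show ?thesis
      unfolding G_def by (rule bcontfun_normI) (use B cl in auto)
  qed
  define T where "T \<phi> = Bcontfun (G \<phi>)" for \<phi>
  have T: "apply_bcontfun (T \<phi>) = G \<phi>" for \<phi>
    unfolding T_def by (rule Bcontfun_inverse[OF G_bcontfun])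
  have "dist (T \<phi>) (T \<psi>) \<le> (4 * d * \<bar>K\<bar>) * dist \<phi> \<psi>" for \<phi> \<psi>
  proof (rule dist_bound)
    fix t
    let ?D = "\<lambda>s. F s (apply_bcontfun \<phi> s) - F s (apply_bcontfun \<psi> s)"
    have int: "integral {l..s} ?D = integral {l..s} (\<lambda>s. F s (apply_bcontfun \<phi> s))
        - integral {l..s} (\<lambda>s. F s (apply_bcontfun \<psi> s))" if "s \<in> {l..r}" for s
      using that by (intro Henstock_Kurzweil_Integration.integral_diff integrable_continuous_real
        continuous_on_subset[OF cont_app]) auto
    have bnd: "norm (integral {l..s} ?D) \<le> (2 * d) * (\<bar>K\<bar> * dist \<phi> \<psi>)" if s: "s \<in> {l..r}" for s
    proof -
      have "norm (integral {l..s} ?D) \<le> (\<bar>K\<bar> * dist \<phi> \<psi>) * (s - l)"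
      proof (rule integral_bound)
        show "continuous_on {l..s} ?D"
          using s by (intro continuous_on_diff continuous_on_subset[OF cont_app]) auto
        fix x assume "x \<in> {l..s}"
        then have "norm (?D x) \<le> K * norm (apply_bcontfun \<phi> x - apply_bcontfun \<psi> x)"
          using s lr(4) by (intro lip) auto
        also have "\<dots> \<le> \<bar>K\<bar> * dist \<phi> \<psi>"
          using dist_bounded[of \<phi> x \<psi>] by (intro mult_mono) (auto simp: dist_norm)
        finally show "norm (?D x) \<le> \<bar>K\<bar> * dist \<phi> \<psi>" .
      qed (use s in auto)
      also have "\<dots> \<le> (\<bar>K\<bar> * dist \<phi> \<psi>) * (2 * d)"
        using s lr(3) by (intro mult_left_mono) auto
      finally show ?thesis by (simp add: mult.commute)
    qed
    have "dist (apply_bcontfun (T \<phi>) t) (apply_bcontfun (T \<psi>) t)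
        = norm (integral {l..cl t} ?D - integral {l..t0} ?D)"
      using cl[of t] lr by (simp add: T G_def dist_norm int algebra_simps)
    also have "\<dots> \<le> (2 * d) * (\<bar>K\<bar> * dist \<phi> \<psi>) + (2 * d) * (\<bar>K\<bar> * dist \<phi> \<psi>)"
      using cl[of t] lr by (intro order_trans[OF norm_triangle_ineq4] add_mono bnd) auto
    finally show "dist (apply_bcontfun (T \<phi>) t) (apply_bcontfun (T \<psi>) t) \<le> (4 * d * \<bar>K\<bar>) * dist \<phi> \<psi>"
      by simp
  qed
  then obtain \<phi> where "T \<phi> = \<phi>"
    using banach_fix_type[of "4 * d * \<bar>K\<bar>" T] contr d(1)
    by (metis abs_ge_zero less_imp_le mult_nonneg_nonneg zero_le_numeral)
  then have "apply_bcontfun \<phi> t = G \<phi> t" for t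
    using T[of \<phi>] by simp
  moreover have "cl t = t" if "t \<in> {l..r}" for t
    using that by (simp add: cl_def)
  ultimately have \<phi>: "apply_bcontfun \<phi> t = x0 + integral {l..t} (\<lambda>s. F s (apply_bcontfun \<phi> s))
      - integral {l..t0} (\<lambda>s. F s (apply_bcontfun \<phi> s))" if "t \<in> {l..r}" for t
    unfolding G_def using that by metis
  show thesis
  proof (rule that[of d "apply_bcontfun \<phi>"])
    show "apply_bcontfun \<phi> t0 = x0" using \<phi>[of t0] lr by simp
    fix t assume "t \<in> {t0 - d<..<t0 + d}"
    then have t: "t \<in> {l<..<r}" by (simp add: l_def r_def)
    then have "((\<lambda>t. integral {l..t} (\<lambda>s. F s (apply_bcontfun \<phi> s))) has_vector_derivative
        F t (apply_bcontfun \<phi> t)) (at t within {l..r})"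
      by (intro integral_has_vector_derivative cont_app) auto
    then have "((\<lambda>t. integral {l..t} (\<lambda>s. F s (apply_bcontfun \<phi> s))) has_vector_derivative
        F t (apply_bcontfun \<phi> t)) (at t)"
      using t by (auto simp: at_within_Icc_at)
    then have "((\<lambda>t. x0 + integral {l..t} (\<lambda>s. F s (apply_bcontfun \<phi> s))
        - integral {l..t0} (\<lambda>s. F s (apply_bcontfun \<phi> s))) has_vector_derivative
        F t (apply_bcontfun \<phi> t)) (at t)"
      by (auto intro!: derivative_eq_intros)
    then show "(apply_bcontfun \<phi> has_vector_derivative F t (apply_bcontfun \<phi> t)) (at t)"
      by (rule has_vector_derivative_transform_within_open[where S = "{l<..<r}"]) (use t \<phi>[symmetric] in auto)
  qed (use d lr in \<open>auto simp: l_def r_def\<close>)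
qed

section \<open>Null frames and their structure equations\<close>

text \<open>Only scalar products are recorded, since these are what the structure equations
  propagate; the basis property is recovered by \<open>null_frame_expansion\<close>. The conditions
  are invariant under x -> f x, y -> y / f, so they suit \<xi> and \<eta> as well.\<close>

definition null_frame :: "real^4 \<Rightarrow> real^4 \<Rightarrow> real^4 \<Rightarrow> real^4 \<Rightarrow> bool" where
  "null_frame x y n1 n2 \<longleftrightarrow>
     mink x x = 0 \<and> mink y y = 0 \<and> mink x y = -1 \<and>
     mink n1 n1 = 1 \<and> mink n2 n2 = 1 \<and> mink n1 n2 = 0 \<and>
     mink x n1 = 0 \<and> mink x n2 = 0 \<and> mink y n1 = 0 \<and> mink y n2 = 0"

lemma mink_nondegenerate:
  assumes "\<And>b. mink v b = mink w b"
  shows "v = w"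
  using assms[of "axis 1 1"] assms[of "axis 2 1"] assms[of "axis 3 1"] assms[of "axis 4 1"]
  by (simp add: mink_def axis_def vec_eq_iff forall_4)

lemmas mink_simps = mink.add_left mink.add_right mink.diff_left mink.diff_right
  mink.scaleR_left mink.scaleR_right mink.minus_left mink.minus_right mink.zero_left mink.zero_right

lemma null_frame_mink:
  assumes "null_frame x y n1 n2"
  shows "mink x x = 0" "mink y y = 0" "mink x y = -1" "mink y x = -1"
    "mink n1 n1 = 1" "mink n2 n2 = 1" "mink n1 n2 = 0" "mink n2 n1 = 0"
    "mink x n1 = 0" "mink n1 x = 0" "mink x n2 = 0" "mink n2 x = 0"
    "mink y n1 = 0" "mink n1 y = 0" "mink y n2 = 0" "mink n2 y = 0"
  using assms mink_commute[of y x] mink_commute[of n2 n1] mink_commute[of n1 x] mink_commute[of n2 x]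
    mink_commute[of n1 y] mink_commute[of n2 y]
  by (simp_all add: null_frame_def)

lemma vector_4:
  fixes a b c d :: "'a::zero"
  shows "(vector [a, b, c, d] :: 'a^4) $ 1 = a" "(vector [a, b, c, d] :: 'a^4) $ 2 = b"
    "(vector [a, b, c, d] :: 'a^4) $ 3 = c" "(vector [a, b, c, d] :: 'a^4) $ 4 = d"
  unfolding vector_def by simp_all

text \<open>The map from coefficients to vectors. As a linear endomap of \<open>real^4\<close> it is
  injective iff surjective; the two directions drive the next two results on frames.\<close>

definition combine :: "real^4 \<Rightarrow> real^4 \<Rightarrow> real^4 \<Rightarrow> real^4 \<Rightarrow> real^4 \<Rightarrow> real^4" where
  "combine x y n1 n2 c = c $ 1 *\<^sub>R x + c $ 2 *\<^sub>R y + c $ 3 *\<^sub>R n1 + c $ 4 *\<^sub>R n2"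

lemma linear_combine: "linear (combine x y n1 n2)"
  by (rule linearI) (simp_all add: combine_def algebra_simps)

text \<open>Pairing with the frame recovers all coefficients, so \<open>combine\<close> is
  injective, hence onto. As <x,y> = -1, the coefficient along x is read off by pairing with y, up to
  sign, and vice versa.\<close>

lemma null_frame_expansion:
  assumes "null_frame x y n1 n2"
  shows "v = - mink v y *\<^sub>R x - mink v x *\<^sub>R y + mink v n1 *\<^sub>R n1 + mink v n2 *\<^sub>R n2"
proof -
  note fr = null_frame_mink[OF assms]
  have "inj (combine x y n1 n2)"
  proof (rule linear_injective_0[THEN iffD2, OF linear_combine, rule_format])
    fix c assume c: "combine x y n1 n2 c = 0"
    have "mink (combine x y n1 n2 c) a = 0" for a by (simp add: c mink_simps)
    from this[of x] this[of y] this[of n1] this[of n2] show "c = 0"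
      by (simp add: combine_def mink_simps fr vec_eq_iff forall_4)
  qed
  then have "surj (combine x y n1 n2)"
    by (rule linear_injective_imp_surjective[OF linear_combine]) simp
  then obtain c where "v = combine x y n1 n2 c" by (metis surjD)
  then show ?thesis by (simp add: combine_def mink_simps fr)
qed

text \<open>The expansion makes \<open>combine\<close> onto, hence injective, so coefficients are
  unique. Expanding the four frame vectors themselves and comparing with unit coefficient vectors
  yields the whole Gram matrix.\<close>

lemma null_frame_of_expansion:
  assumes "\<And>a. a = - mink y a *\<^sub>R x - mink x a *\<^sub>R y + mink n1 a *\<^sub>R n1 + mink n2 a *\<^sub>R n2"
  shows "null_frame x y n1 n2"
proof -
  have "v = combine x y n1 n2 (vector [- mink y v, - mink x v, mink n1 v, mink n2 v])" for v
    using assms[of v] by (simp add: combine_def vector_4)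
  then have "surj (combine x y n1 n2)" unfolding surj_def by blast
  then have inj: "inj (combine x y n1 n2)"
    by (rule linear_surjective_imp_injective[OF linear_combine]) simp
  have coeff: "c = vector [- mink y v, - mink x v, mink n1 v, mink n2 v]"
    if "v = combine x y n1 n2 c" for v c
  proof (rule injD[OF inj])
    show "combine x y n1 n2 c = combine x y n1 n2 (vector [- mink y v, - mink x v, mink n1 v, mink n2 v])"
      using that assms[of v] by (simp add: combine_def vector_4)
  qed
  have "vector [1, 0, 0, 0] = (vector [- mink y x, - mink x x, mink n1 x, mink n2 x] :: real^4)"
    "vector [0, 1, 0, 0] = (vector [- mink y y, - mink x y, mink n1 y, mink n2 y] :: real^4)"
    "vector [0, 0, 1, 0] = (vector [- mink y n1, - mink x n1, mink n1 n1, mink n2 n1] :: real^4)"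
    "vector [0, 0, 0, 1] = (vector [- mink y n2, - mink x n2, mink n1 n2, mink n2 n2] :: real^4)"
    by (rule coeff; simp add: combine_def vector_4)+
  then show ?thesis
    by (simp add: vec_eq_iff forall_4 vector_4 null_frame_def)
qed

text \<open>Gauss and Weingarten formulas for \<xi> = z_u, \<eta> = z_v / F. In the uses \<alpha> =
  F lam1 and \<beta> = F mu1, and \<open>c\<close> is the normal connection coefficient <(n1)_u,
  n2>. The coefficients are left arbitrary here, as conservation rests on skewness alone.\<close>

definition frame_system where
  "frame_system S F L \<nu> \<alpha> \<beta> c \<xi> \<eta> n1 n2 \<longleftrightarrow> (\<forall>p\<in>S.
     has_pd \<xi> (L p *\<^sub>R \<xi> p + \<alpha> p *\<^sub>R n1 p + \<beta> p *\<^sub>R n2 p) (- (F p * \<nu> p) *\<^sub>R n1 p) p \<and>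
     has_pd \<eta> (- L p *\<^sub>R \<eta> p - \<nu> p *\<^sub>R n1 p) 0 p \<and>
     has_pd n1 (- \<nu> p *\<^sub>R \<xi> p + \<alpha> p *\<^sub>R \<eta> p + c p *\<^sub>R n2 p) (- (F p * \<nu> p) *\<^sub>R \<eta> p) p \<and>
     has_pd n2 (\<beta> p *\<^sub>R \<eta> p - c p *\<^sub>R n1 p) 0 p)"

lemma frame_systemD:
  assumes "frame_system S F L \<nu> \<alpha> \<beta> c \<xi> \<eta> n1 n2" "p \<in> S"
  shows "has_pd \<xi> (L p *\<^sub>R \<xi> p + \<alpha> p *\<^sub>R n1 p + \<beta> p *\<^sub>R n2 p) (- (F p * \<nu> p) *\<^sub>R n1 p) p"
    and "has_pd \<eta> (- L p *\<^sub>R \<eta> p - \<nu> p *\<^sub>R n1 p) 0 p"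
    and "has_pd n1 (- \<nu> p *\<^sub>R \<xi> p + \<alpha> p *\<^sub>R \<eta> p + c p *\<^sub>R n2 p) (- (F p * \<nu> p) *\<^sub>R \<eta> p) p"
    and "has_pd n2 (\<beta> p *\<^sub>R \<eta> p - c p *\<^sub>R n1 p) 0 p"
  using assms by (simp_all add: frame_system_def)

text \<open>The coefficient matrix of the system is skew for the scalar products of a null frame, so the
  two-point tensor built with the inverse of their Gram matrix is constant.\<close>

lemma frame_system_tensor_const:
  assumes "open S" "connected S"
    and sys: "frame_system S F L \<nu> \<alpha> \<beta> c \<xi> \<eta> n1 n2"
    and sys': "frame_system S F L \<nu> \<alpha> \<beta> c \<xi>' \<eta>' n1' n2'"
    and "p \<in> S" "q \<in> S"
  defines "T \<equiv> \<lambda>p a b. - (mink (\<xi> p) a * mink (\<eta>' p) b) - mink (\<eta> p) a * mink (\<xi>' p) b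
      + mink (n1 p) a * mink (n1' p) b + mink (n2 p) a * mink (n2' p) b"
  shows "T p a b = T q a b"
proof -
  have "((\<lambda>p. T p a b) has_derivative (\<lambda>h. 0)) (at r)" if "r \<in> S" for r
  proof -
    note pd = frame_systemD[OF sys that] frame_systemD[OF sys' that]
    have "has_pd (\<lambda>p. T p a b) 0 0 r"
      unfolding T_def
      by (rule has_pd_eq_rhs, (rule pd_intros pd)+)
        (simp_all add: mink_simps algebra_simps)
    then show ?thesis by (simp add: has_pd_def)
  qed
  then show ?thesis
    by (rule has_derivative_zero_unique_connected[OF assms(1,2) _ assms(5,6)])
qed

text \<open>With the solution paired with itself, the constant tensor is the resolution of the
  identity at \<open>q\<close>. It is therefore the same at \<open>p\<close>, and
  \<open>null_frame_of_expansion\<close> turns this back into scalar products.\<close>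

lemma frame_system_null_frame:
  assumes "open S" "connected S" "frame_system S F L \<nu> \<alpha> \<beta> c \<xi> \<eta> n1 n2"
    and "p \<in> S" "q \<in> S" "null_frame (\<xi> q) (\<eta> q) (n1 q) (n2 q)"
  shows "null_frame (\<xi> p) (\<eta> p) (n1 p) (n2 p)"
proof (rule null_frame_of_expansion)
  fix a
  let ?E = "\<lambda>p. - mink (\<eta> p) a *\<^sub>R \<xi> p - mink (\<xi> p) a *\<^sub>R \<eta> p + mink (n1 p) a *\<^sub>R n1 p + mink (n2 p) a *\<^sub>R n2 p"
  have "mink (?E p) b = mink (?E q) b" for b
    using frame_system_tensor_const[OF assms(1,2,3,3,4,5), of a b] by (simp add: mink_simps algebra_simps)
  moreover have "?E q = a"
    using null_frame_expansion[OF assms(6), of a] by (simp add: mink_commute)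
  ultimately show "a = ?E p" by (intro mink_nondegenerate) simp
qed

text \<open>As the solutions agree at \<open>q\<close>, the mixed tensor equals the metric there,
  hence also at \<open>p\<close>. Inserting a vector of the primed null frame for b leaves a single
  term, which identifies the corresponding vectors.\<close>

lemma frame_system_unique:
  assumes "open S" "connected S"
    and sys: "frame_system S F L \<nu> \<alpha> \<beta> c \<xi> \<eta> n1 n2"
    and sys': "frame_system S F L \<nu> \<alpha> \<beta> c \<xi>' \<eta>' n1' n2'"
    and "p \<in> S" "q \<in> S" and fr: "null_frame (\<xi> q) (\<eta> q) (n1 q) (n2 q)"
    and eq: "\<xi>' q = \<xi> q" "\<eta>' q = \<eta> q" "n1' q = n1 q" "n2' q = n2 q"
  shows "\<xi>' p = \<xi> p" "\<eta>' p = \<eta> p" "n1' p = n1 p" "n2' p = n2 p"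
proof -
  have fr': "null_frame (\<xi>' p) (\<eta>' p) (n1' p) (n2' p)"
    using fr by (intro frame_system_null_frame[OF assms(1,2) sys' assms(5,6)]) (simp add: eq)
  note fr' = null_frame_mink[OF this]
  have T: "- (mink (\<xi> p) a * mink (\<eta>' p) b) - mink (\<eta> p) a * mink (\<xi>' p) b
      + mink (n1 p) a * mink (n1' p) b + mink (n2 p) a * mink (n2' p) b = mink b a" for a b
  proof -
    have "mink b a = mink (- mink b (\<eta> q) *\<^sub>R \<xi> q - mink b (\<xi> q) *\<^sub>R \<eta> q
        + mink b (n1 q) *\<^sub>R n1 q + mink b (n2 q) *\<^sub>R n2 q) a"
      using null_frame_expansion[OF fr, of b] by simp
    then show ?thesis
      using frame_system_tensor_const[OF assms(1,2) sys sys' assms(5,6), of a b]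
      by (simp add: eq mink_simps mink_commute algebra_simps)
  qed
  have "mink (\<xi>' p) a = mink (\<xi> p) a" "mink (\<eta>' p) a = mink (\<eta> p) a"
    "mink (n1' p) a = mink (n1 p) a" "mink (n2' p) a = mink (n2 p) a" for a
    using T[of a "\<xi>' p"] T[of a "\<eta>' p"] T[of a "n1' p"] T[of a "n2' p"] by (simp_all add: fr')
  then show "\<xi>' p = \<xi> p" "\<eta>' p = \<eta> p" "n1' p = n1 p" "n2' p = n2 p"
    by (simp_all add: mink_nondegenerate)
qed

section \<open>Isotropic surfaces from solutions of the structure equations\<close>

text \<open>The projection along span {x, y} onto its orthogonal complement when x, y are null with
  <x,y> = -1.\<close>

definition nproj :: "real^4 \<Rightarrow> real^4 \<Rightarrow> real^4 \<Rightarrow> real^4" where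
  "nproj x y v = v + mink v y *\<^sub>R x + mink v x *\<^sub>R y"

lemma nproj_simps:
  "nproj x y (v + w) = nproj x y v + nproj x y w" "nproj x y (v - w) = nproj x y v - nproj x y w"
  "nproj x y (k *\<^sub>R v) = k *\<^sub>R nproj x y v" "nproj x y (- v) = - nproj x y v" "nproj x y 0 = 0"
  by (simp_all add: nproj_def mink_simps algebra_simps)

section \<open>Tangent plane, normal part and second fundamental form at a point with null
  coordinate directions\<close>

context
  fixes z :: "real \<times> real \<Rightarrow> real^4" and x y :: "real^4" and k l :: real and p :: "real \<times> real"
  assumes pd: "has_pd z (k *\<^sub>R x) (l *\<^sub>R y) p" and kl: "k \<noteq> 0" "l \<noteq> 0"
    and null: "mink x x = 0" "mink y y = 0" "mink x y = -1"
begin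

lemma frechet_null: "frechet_derivative z (at p) = (\<lambda>h. (fst h * k) *\<^sub>R x + (snd h * l) *\<^sub>R y)"
  using has_pd_frechet[OF pd] by simp

lemma null_coeff:
  assumes "a *\<^sub>R x + b *\<^sub>R y = a' *\<^sub>R x + b' *\<^sub>R y"
  shows "a = a'" "b = b'"
proof -
  have "mink (a *\<^sub>R x + b *\<^sub>R y) w = mink (a' *\<^sub>R x + b' *\<^sub>R y) w" for w
    using assms by simp
  from this[of x] this[of y] show "a = a'" "b = b'"
    by (simp_all add: mink_simps null mink_commute[of y x])
qed

lemma inj_frechet_null: "inj (frechet_derivative z (at p))"
proof (rule injI)
  fix h h' assume "frechet_derivative z (at p) h = frechet_derivative z (at p) h'"
  then show "h = h'"
    using null_coeff[of "fst h * k" "snd h * l" "fst h' * k" "snd h' * l"] kl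
    by (simp add: frechet_null prod_eq_iff)
qed

lemma tangent_plane_null: "tangent_plane z p = {a *\<^sub>R x + b *\<^sub>R y |a b. True}"
proof -
  have "a *\<^sub>R x + b *\<^sub>R y \<in> range (frechet_derivative z (at p))" for a b
    by (rule range_eqI[of _ _ "(a / k, b / l)"]) (simp add: frechet_null kl)
  then show ?thesis unfolding tangent_plane_def frechet_null by auto
qed

lemma normal_plane_null: "normal_plane z p = {n. mink n x = 0 \<and> mink n y = 0}"
proof -
  have "mink n (1 *\<^sub>R x + 0 *\<^sub>R y) = 0 \<and> mink n (0 *\<^sub>R x + 1 *\<^sub>R y) = 0" if "n \<in> normal_plane z p" for n
    using that unfolding normal_plane_def tangent_plane_null by blast
  then show ?thesis
    unfolding normal_plane_def tangent_plane_null by (auto simp: mink_simps)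
qed

text \<open>The definite description has a value because the tangent plane is nondegenerate:
  \<open>nproj\<close> gives one decomposition, and pairing with x and y rules out any
  other.\<close>

lemma normal_part_null: "normal_part z p w = nproj x y w"
  unfolding normal_part_def
proof (rule the_equality)
  have "w - nproj x y w = (- mink w y) *\<^sub>R x + (- mink w x) *\<^sub>R y"
    by (simp add: nproj_def)
  then have "w - nproj x y w \<in> tangent_plane z p"
    unfolding tangent_plane_null by blast
  moreover have "nproj x y w \<in> normal_plane z p"
    unfolding normal_plane_null by (simp add: nproj_def mink_simps null mink_commute[of y x])
  ultimately show "nproj x y w \<in> normal_plane z p \<and> w - nproj x y w \<in> tangent_plane z p"
    by blast
next
  fix n assume n: "n \<in> normal_plane z p \<and> w - n \<in> tangent_plane z p"
  then obtain a b where "w - n = a *\<^sub>R x + b *\<^sub>R y"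
    unfolding tangent_plane_null by blast
  then have w: "w = n + a *\<^sub>R x + b *\<^sub>R y" by (simp add: algebra_simps)
  show "n = nproj x y w"
    using n unfolding normal_plane_null
    by (simp add: w nproj_def mink_simps null mink_commute[of y x])
qed

lemma flat_connection_null:
  assumes "X p = (a * k) *\<^sub>R x + (b * l) *\<^sub>R y" "has_pd Y yu yv p"
  shows "flat_connection z X Y p = a *\<^sub>R yu + b *\<^sub>R yv"
proof -
  have "X p = frechet_derivative z (at p) (a, b)" using assms(1) by (simp add: frechet_null)
  then have "inv (frechet_derivative z (at p)) (X p) = (a, b)"
    using inv_f_f[OF inj_frechet_null] by simp
  then show ?thesis
    by (simp add: flat_connection_def has_pd_frechet[OF assms(2)])
qed

lemma second_fund_null:
  assumes "X p = (a * k) *\<^sub>R x + (b * l) *\<^sub>R y" "has_pd Y yu yv p"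
  shows "second_fund z X Y p = a *\<^sub>R nproj x y yu + b *\<^sub>R nproj x y yv"
  by (simp add: second_fund_def flat_connection_null[of X a b Y, OF assms] normal_part_null nproj_simps)

lemma tangent_plane_indefinite:
  "(\<exists>t\<in>tangent_plane z p. mink t t > 0) \<and> (\<exists>t\<in>tangent_plane z p. mink t t < 0)"
proof
  \<comment> \<open>The vectors x - y and x + y have squares 2 and -2.\<close>
  have "1 *\<^sub>R x + (-1) *\<^sub>R y \<in> tangent_plane z p" "1 *\<^sub>R x + 1 *\<^sub>R y \<in> tangent_plane z p"
    unfolding tangent_plane_null by blast+
  moreover have "mink (1 *\<^sub>R x + (-1) *\<^sub>R y) (1 *\<^sub>R x + (-1) *\<^sub>R y) > 0"
    "mink (1 *\<^sub>R x + 1 *\<^sub>R y) (1 *\<^sub>R x + 1 *\<^sub>R y) < 0"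
    by (simp_all add: mink_simps null mink_commute[of y x])
  ultimately show "\<exists>t\<in>tangent_plane z p. mink t t > 0" "\<exists>t\<in>tangent_plane z p. mink t t < 0"
    by blast+
qed

end

text \<open>Since x = \<xi> / f and y = f \<eta>, derivatives of the factors produce only multiples
  of \<xi> and \<eta>, which \<open>nproj\<close> kills. In the trace E = G = 0, so only the two
  mixed terms remain: one is the normal part of \<xi>_v, the other of F \<eta>_u.\<close>

lemma isotropic_second_fund:
  fixes f :: "real \<times> real \<Rightarrow> real"
  assumes D: "open D" "p \<in> D" and f: "smooth_on f D" "\<forall>q\<in>D. f q > 0"
    and z: "\<forall>q\<in>D. has_pd z (\<xi> q) ((f q)\<^sup>2 *\<^sub>R \<eta> q) q"
    and \<xi>: "has_pd \<xi> \<xi>u \<xi>v p" and \<eta>: "has_pd \<eta> \<eta>u \<eta>v p"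
    and null: "mink (\<xi> p) (\<xi> p) = 0" "mink (\<eta> p) (\<eta> p) = 0" "mink (\<xi> p) (\<eta> p) = -1"
  shows "second_fund z (geo_x f z) (geo_x f z) p = (1 / (f p)\<^sup>2) *\<^sub>R nproj (\<xi> p) (\<eta> p) \<xi>u"
    and "second_fund z (geo_x f z) (geo_y f z) p = nproj (\<xi> p) (\<eta> p) \<eta>u"
    and "second_fund z (geo_y f z) (geo_y f z) p = nproj (\<xi> p) (\<eta> p) \<eta>v"
    and "mean_curvature z p = - (1 / (2 * (f p)\<^sup>2)) *\<^sub>R
      (nproj (\<xi> p) (\<eta> p) \<xi>v + (f p)\<^sup>2 *\<^sub>R nproj (\<xi> p) (\<eta> p) \<eta>u)"
proof -
  have fp: "f p \<noteq> 0" using f(2) D(2) by force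
  have zp: "has_pd z (1 *\<^sub>R \<xi> p) ((f p)\<^sup>2 *\<^sub>R \<eta> p) p" using z D(2) by simp
  have sq: "(f p)\<^sup>2 \<noteq> 0" using fp by simp
  note sf = second_fund_null[OF zp one_neq_zero sq null]
  have tang: "nproj (\<xi> p) (\<eta> p) (\<xi> p) = 0" "nproj (\<xi> p) (\<eta> p) (\<eta> p) = 0"
    by (simp_all add: nproj_def null mink_commute[of "\<eta> p" "\<xi> p"])
  note pz = has_pd_unique[OF z[rule_format]]
  note fpd = smooth_on_has_pd[OF f(1) D(2)]
  have "has_pd (\<lambda>q. (1 / f q) *\<^sub>R \<xi> q) ((1 / f p) *\<^sub>R \<xi>u - (pd_u f p / (f p)\<^sup>2) *\<^sub>R \<xi> p)
      ((1 / f p) *\<^sub>R \<xi>v - (pd_v f p / (f p)\<^sup>2) *\<^sub>R \<xi> p) p"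
    by (rule has_pd_eq_rhs, (rule pd_intros fpd \<xi> fp)+) simp_all
  from has_pd_cong[OF this D]
  have gx: "has_pd (geo_x f z) ((1 / f p) *\<^sub>R \<xi>u - (pd_u f p / (f p)\<^sup>2) *\<^sub>R \<xi> p)
      ((1 / f p) *\<^sub>R \<xi>v - (pd_v f p / (f p)\<^sup>2) *\<^sub>R \<xi> p) p"
    by (simp add: geo_x_def pz)
  have "has_pd (\<lambda>q. f q *\<^sub>R \<eta> q) (f p *\<^sub>R \<eta>u + pd_u f p *\<^sub>R \<eta> p)
      (f p *\<^sub>R \<eta>v + pd_v f p *\<^sub>R \<eta> p) p"
    by (rule pd_intros fpd \<eta>)+
  from has_pd_cong[OF this D]
  have gy: "has_pd (geo_y f z) (f p *\<^sub>R \<eta>u + pd_u f p *\<^sub>R \<eta> p) (f p *\<^sub>R \<eta>v + pd_v f p *\<^sub>R \<eta> p) p"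
    using f(2) by (simp add: geo_y_def pz power2_eq_square)
  have xp: "geo_x f z p = ((1 / f p) * 1) *\<^sub>R \<xi> p + (0 * (f p)\<^sup>2) *\<^sub>R \<eta> p"
    by (simp add: geo_x_def pz[OF D(2)])
  have yp: "geo_y f z p = (0 * 1) *\<^sub>R \<xi> p + ((1 / f p) * (f p)\<^sup>2) *\<^sub>R \<eta> p"
    by (simp add: geo_y_def pz[OF D(2)])
  show "second_fund z (geo_x f z) (geo_x f z) p = (1 / (f p)\<^sup>2) *\<^sub>R nproj (\<xi> p) (\<eta> p) \<xi>u"
    by (simp add: sf[of "geo_x f z" "1 / f p" 0 "geo_x f z", OF xp gx] nproj_simps tang power2_eq_square)
  show "second_fund z (geo_x f z) (geo_y f z) p = nproj (\<xi> p) (\<eta> p) \<eta>u"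
    by (simp add: sf[of "geo_x f z" "1 / f p" 0 "geo_y f z", OF xp gy] nproj_simps tang fp)
  show "second_fund z (geo_y f z) (geo_y f z) p = nproj (\<xi> p) (\<eta> p) \<eta>v"
    by (simp add: sf[of "geo_y f z" 0 "1 / f p" "geo_y f z", OF yp gy] nproj_simps tang fp)
  have zu: "has_pd (pd_u z) \<xi>u \<xi>v p"
    by (rule has_pd_cong[OF \<xi> D]) (simp add: pz)
  have "has_pd (\<lambda>q. (f q)\<^sup>2 *\<^sub>R \<eta> q) ((f p)\<^sup>2 *\<^sub>R \<eta>u + (2 * f p * pd_u f p) *\<^sub>R \<eta> p)
      ((f p)\<^sup>2 *\<^sub>R \<eta>v + (2 * f p * pd_v f p) *\<^sub>R \<eta> p) p"
    by (rule pd_intros fpd \<eta>)+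
  then have zv: "has_pd (pd_v z) ((f p)\<^sup>2 *\<^sub>R \<eta>u + (2 * f p * pd_u f p) *\<^sub>R \<eta> p)
      ((f p)\<^sup>2 *\<^sub>R \<eta>v + (2 * f p * pd_v f p) *\<^sub>R \<eta> p) p"
    by (rule has_pd_cong[OF _ D]) (simp add: pz)
  have up: "pd_u z p = (1 * 1) *\<^sub>R \<xi> p + (0 * (f p)\<^sup>2) *\<^sub>R \<eta> p"
    and vp: "pd_v z p = (0 * 1) *\<^sub>R \<xi> p + (1 * (f p)\<^sup>2) *\<^sub>R \<eta> p"
    by (simp_all add: pz[OF D(2)])
  have "mink (pd_u z p) (pd_u z p) = 0" "mink (pd_v z p) (pd_v z p) = 0"
    "mink (pd_u z p) (pd_v z p) = - (f p)\<^sup>2"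
    by (simp_all add: pz[OF D(2)] mink_simps null)
  then show "mean_curvature z p = - (1 / (2 * (f p)\<^sup>2)) *\<^sub>R
      (nproj (\<xi> p) (\<eta> p) \<xi>v + (f p)\<^sup>2 *\<^sub>R nproj (\<xi> p) (\<eta> p) \<eta>u)"
    unfolding mean_curvature_def Let_def sf[of "pd_u z" 1 0 "pd_v z", OF up zv]
      sf[of "pd_v z" 0 1 "pd_u z", OF vp zu] sf[of "pd_u z" 1 0 "pd_u z", OF up zu]
      sf[of "pd_v z" 0 1 "pd_v z", OF vp zv]
    by (simp add: nproj_simps tang fp power2_eq_square scaleR_add_right scaleR_diff_right)
qed

text \<open>Both mixed terms in the mean curvature are -F \<nu> n1, so H = \<nu> n1; with \<nu> > 0
  the field \<open>n1\<close> is the prescribed direction of H and not merely its multiple. The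
  equation \<eta>_v = 0 makes lam2 and mu2 vanish.\<close>

lemma surface_with_data_of_frame_system:
  assumes D: "planar_domain D" "q \<in> D"
    and f: "smooth_on f D" "\<And>p. p \<in> D \<Longrightarrow> f p > 0"
    and \<nu>: "\<And>p. p \<in> D \<Longrightarrow> \<nu> p > 0" and \<mu>: "\<And>p. p \<in> D \<Longrightarrow> mu1 p \<noteq> 0"
    and sys: "frame_system D (\<lambda>p. (f p)\<^sup>2) L \<nu> (\<lambda>p. (f p)\<^sup>2 * lam1 p) (\<lambda>p. (f p)\<^sup>2 * mu1 p) c \<xi> \<eta> n1 n2"
    and fr: "\<And>p. p \<in> D \<Longrightarrow> null_frame (\<xi> p) (\<eta> p) (n1 p) (n2 p)"
    and z: "smooth_on z D" "\<And>p. p \<in> D \<Longrightarrow> has_pd z (\<xi> p) ((f p)\<^sup>2 *\<^sub>R \<eta> p) p"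
    and n2: "smooth_on n2 D"
    and init: "z q = p0" "\<xi> q = f q *\<^sub>R x0" "\<eta> q = (1 / f q) *\<^sub>R y0" "n1 q = n10" "n2 q = n20"
  shows "surface_with_data D f lam1 mu1 q p0 x0 y0 n10 n20 z"
proof -
  have "open D" using D by (simp add: planar_domain_def)
  have fnz: "f p \<noteq> 0" if "p \<in> D" for p using f(2)[OF that] by simp
  note pz = has_pd_unique[OF z(2)]
  have zp: "has_pd z (1 *\<^sub>R \<xi> p) ((f p)\<^sup>2 *\<^sub>R \<eta> p) p" if "p \<in> D" for p using z(2)[OF that] by simp
  have np: "nproj (\<xi> p) (\<eta> p) (\<xi> p) = 0" "nproj (\<xi> p) (\<eta> p) (\<eta> p) = 0"
    "nproj (\<xi> p) (\<eta> p) (n1 p) = n1 p" "nproj (\<xi> p) (\<eta> p) (n2 p) = n2 p" if "p \<in> D" for p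
    by (simp_all add: nproj_def null_frame_mink[OF fr[OF that]])
  have f': "\<forall>q\<in>D. f q > 0" and z': "\<forall>q\<in>D. has_pd z (\<xi> q) ((f q)\<^sup>2 *\<^sub>R \<eta> q) q"
    using f z by blast+
  have sf: "second_fund z (geo_x f z) (geo_x f z) p = lam1 p *\<^sub>R n1 p + mu1 p *\<^sub>R n2 p"
    "second_fund z (geo_x f z) (geo_y f z) p = - (\<nu> p *\<^sub>R n1 p)"
    "second_fund z (geo_y f z) (geo_y f z) p = 0"
    "mean_curvature z p = \<nu> p *\<^sub>R n1 p" if p: "p \<in> D" for p
  proof -
    note isf = isotropic_second_fund[OF \<open>open D\<close> p f(1) f' z' frame_systemD(1)[OF sys p]
        frame_systemD(2)[OF sys p] null_frame_mink(1-3)[OF fr[OF p]]]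
    note simps = nproj_simps np[OF p] fnz[OF p]
    show "second_fund z (geo_x f z) (geo_x f z) p = lam1 p *\<^sub>R n1 p + mu1 p *\<^sub>R n2 p"
      unfolding isf(1) by (simp add: simps scaleR_add_right)
    show "second_fund z (geo_x f z) (geo_y f z) p = - (\<nu> p *\<^sub>R n1 p)"
      unfolding isf(2) by (simp add: simps)
    show "second_fund z (geo_y f z) (geo_y f z) p = 0"
      unfolding isf(3) by (simp add: simps)
    show "mean_curvature z p = \<nu> p *\<^sub>R n1 p"
      unfolding isf(4) by (simp add: simps vec_eq_iff field_simps)
  qed
  note H = sf(4)
  have nu: "geo_nu z p = \<nu> p" if "p \<in> D" for p
    using \<nu>[OF that] by (simp add: geo_nu_def H that mink_simps null_frame_mink[OF fr[OF that]])
  have n1: "geo_n1 z p = n1 p" if "p \<in> D" for p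
    using \<nu>[OF that] by (simp add: geo_n1_def nu H that)
  note pt = zp one_neq_zero power_not_zero[OF fnz]
    null_frame_mink(1)[OF fr] null_frame_mink(2)[OF fr] null_frame_mink(3)[OF fr]
  have np_plane: "normal_plane z p = {n. mink n (\<xi> p) = 0 \<and> mink n (\<eta> p) = 0}" if "p \<in> D" for p
    by (rule normal_plane_null) (use pt that in blast)+
  have "timelike_surface D z"
    unfolding timelike_surface_def immersed_surface_def
  proof (intro conjI ballI)
    fix p assume p: "p \<in> D"
    show "inj (frechet_derivative z (at p))"
      by (rule inj_frechet_null) (use pt p in blast)+
    have "(\<exists>t\<in>tangent_plane z p. mink t t > 0) \<and> (\<exists>t\<in>tangent_plane z p. mink t t < 0)"
      by (rule tangent_plane_indefinite) (use pt p in blast)+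
    then show "\<exists>t\<in>tangent_plane z p. mink t t > 0" "\<exists>t\<in>tangent_plane z p. mink t t < 0" by blast+
  qed (use D z in auto)
  moreover have "isotropic_parameters D f z"
    unfolding isotropic_parameters_def
    by (simp add: pz f mink_simps null_frame_mink[OF fr])
  moreover have "mean_curvature z p \<noteq> 0" if "p \<in> D" for p
  proof
    assume "mean_curvature z p = 0"
    then have "n1 p = 0" using \<nu>[OF that] by (simp add: H that)
    then show False using null_frame_mink(5)[OF fr[OF that]] by (simp add: mink_simps)
  qed
  ultimately have geo: "geometric_frame_field D f z n2"
    unfolding geometric_frame_field_def using n2
    by (simp add: n1 np_plane null_frame_mink[OF fr])
  have ass: "associated_functions D f z n2 lam1 mu1 (\<lambda>p. 0) (\<lambda>p. 0)"
    unfolding associated_functions_def by (simp add: sf n1 nu)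
  have "third_type_surface D f z"
    unfolding third_type_surface_def
    by (intro exI[of _ n2] exI[of _ lam1] exI[of _ mu1] exI[of _ "\<lambda>p. 0"] conjI geo ass) (use \<mu> in auto)
  moreover have "geo_x f z q = x0" "geo_y f z q = y0"
    using fnz[OF D(2)] by (simp_all add: geo_x_def geo_y_def pz D(2) init power2_eq_square)
  ultimately show ?thesis
    unfolding surface_with_data_def using geo ass init n1[OF D(2)] by metis
qed

section \<open>Structure equations of a surface of third type\<close>

lemma has_pd_const_on:
  assumes "has_pd g a b p" "open S" "p \<in> S" "\<And>q. q \<in> S \<Longrightarrow> g q = k"
  shows "a = 0" "b = 0"
  using has_pd_unique[OF has_pd_cong[OF assms]] has_pd_unique[OF has_pd_const[of k p]] by simp_all

lemma smooth_on_ln_sq: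
  assumes "open S" "smooth_on f S" "\<And>p. p \<in> S \<Longrightarrow> f p > 0"
  shows "smooth_on (ln_sq f) S"
proof -
  have sq: "smooth_on (\<lambda>p. (f p)\<^sup>2) S" using assms by (intro smooth_on_power2)
  have pos: "(f p)\<^sup>2 > 0" if "p \<in> S" for p using assms(3)[OF that] by simp
  show ?thesis
    unfolding smooth_on_def ln_sq_def
    using ck_on_ln[OF assms(1) _ pos, of _ "\<lambda>p. p"] sq[unfolded smooth_on_def] by blast
qed

lemma has_pd_sq:
  assumes "smooth_on f S" "p \<in> S" "open S" "\<And>p. p \<in> S \<Longrightarrow> f p > 0"
  shows "has_pd (\<lambda>p. (f p)\<^sup>2) ((f p)\<^sup>2 * pd_u (ln_sq f) p) ((f p)\<^sup>2 * pd_v (ln_sq f) p) p"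
proof -
  have fp: "f p > 0" using assms by blast
  have sq: "has_pd (\<lambda>p. (f p)\<^sup>2) (2 * f p * pd_u f p) (2 * f p * pd_v f p) p"
    by (intro has_pd_power2 smooth_on_has_pd[OF assms(1,2)])
  have "has_pd (\<lambda>p. ln ((f p)\<^sup>2)) (inverse ((f p)\<^sup>2) * (2 * f p * pd_u f p))
      (inverse ((f p)\<^sup>2) * (2 * f p * pd_v f p)) p"
    by (rule has_pd_compose[OF sq DERIV_ln]) (use fp in simp)
  then have "has_pd (ln_sq f) (inverse ((f p)\<^sup>2) * (2 * f p * pd_u f p))
      (inverse ((f p)\<^sup>2) * (2 * f p * pd_v f p)) p"
    unfolding ln_sq_def[abs_def] .
  from has_pd_unique[OF this] show ?thesis
    by (intro has_pd_eq_rhs[OF sq]) (use fp in simp_all)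
qed

text \<open>For uniqueness it matters that \<open>\<nu>\<close> and \<open>c\<close> are defined
  from f and mu1 alone: every surface with the given data then solves the same system. Constant
  scalar products fix most components of the derivatives; commuting mixed derivatives of w, \<eta>
  and \<xi> fix the others.\<close>

lemma frame_system_of_surface:
  assumes D: "q \<in> D" and f: "smooth_on f D" "\<And>p. p \<in> D \<Longrightarrow> f p > 0"
    and mu1: "smooth_on mu1 D" and lam1: "smooth_on lam1 D"
    and data: "surface_with_data D f lam1 mu1 q p0 x0 y0 n10 n20 w"
  defines "L \<equiv> pd_u (ln_sq f)"
  defines "\<nu> \<equiv> \<lambda>p. sqrt (pd_v L p) / f p"
  defines "c \<equiv> \<lambda>p. - pd_v (\<lambda>p. (f p)\<^sup>2 * mu1 p) p / ((f p)\<^sup>2 * \<nu> p)"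
  obtains \<xi> \<eta> n1 n2
  where "frame_system D (\<lambda>p. (f p)\<^sup>2) L \<nu> (\<lambda>p. (f p)\<^sup>2 * lam1 p) (\<lambda>p. (f p)\<^sup>2 * mu1 p) c \<xi> \<eta> n1 n2"
    and "\<And>p. p \<in> D \<Longrightarrow> has_pd w (\<xi> p) ((f p)\<^sup>2 *\<^sub>R \<eta> p) p"
    and "w q = p0" "\<xi> q = f q *\<^sub>R x0" "\<eta> q = (1 / f q) *\<^sub>R y0" "n1 q = n10" "n2 q = n20"
proof -
  obtain n2 lam2 mu2 where tt: "third_type_surface D f w" and wq: "w q = p0"
    and geo: "geometric_frame_field D f w n2"
    and init: "geo_x f w q = x0" "geo_y f w q = y0" "geo_n1 w q = n10" "n2 q = n20"
    and ass: "associated_functions D f w n2 lam1 mu1 lam2 mu2"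
    using data unfolding surface_with_data_def by blast
  have sm: "smooth_on w D" and "open D" and smn2: "smooth_on n2 D"
    using geo by (auto simp: geometric_frame_field_def timelike_surface_def immersed_surface_def planar_domain_def)
  have iso: "mink (pd_u w p) (pd_u w p) = 0" "mink (pd_v w p) (pd_v w p) = 0"
    "mink (pd_u w p) (pd_v w p) = - (f p)\<^sup>2" if "p \<in> D" for p
    using geo that by (auto simp: geometric_frame_field_def isotropic_parameters_def)
  have fnz: "f p \<noteq> 0" if "p \<in> D" for p using f(2)[OF that] by simp
  define F where "F = (\<lambda>p. (f p)\<^sup>2)"
  have F: "F p > 0" "F p \<noteq> 0" if "p \<in> D" for p using fnz[OF that] by (simp_all add: F_def)
  have smF: "smooth_on F D" unfolding F_def by (intro smooth_on_power2 \<open>open D\<close> f)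
  define \<xi> \<eta> n1 where "\<xi> = pd_u w" and "\<eta> = (\<lambda>p. (1 / F p) *\<^sub>R pd_v w p)" and "n1 = geo_n1 w"
  have sm\<xi>: "smooth_on \<xi> D" unfolding \<xi>_def by (intro smooth_on_pd_u \<open>open D\<close> sm)
  have sm\<eta>: "smooth_on \<eta> D" unfolding \<eta>_def
    by (intro smooth_on_scaleR smooth_on_divide smooth_on_const smooth_on_pd_v smF sm \<open>open D\<close> F)
  have wv: "pd_v w p = F p *\<^sub>R \<eta> p" if "p \<in> D" for p
    using F(2)[OF that] by (simp add: \<eta>_def)
  have pdw: "has_pd w (\<xi> p) (F p *\<^sub>R \<eta> p) p" if "p \<in> D" for p
    using smooth_on_has_pd[OF sm that] wv[OF that] by (simp add: \<xi>_def)
  have null: "mink (\<xi> p) (\<xi> p) = 0" "mink (\<eta> p) (\<eta> p) = 0" "mink (\<xi> p) (\<eta> p) = -1" if "p \<in> D" for p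
    using iso[OF that] F(2)[OF that] by (simp_all add: \<xi>_def \<eta>_def mink_simps) (simp add: F_def)
  have "normal_plane w p = {n. mink n (\<xi> p) = 0 \<and> mink n (\<eta> p) = 0}" if "p \<in> D" for p
    by (rule normal_plane_null[where k = 1 and l = "F p"]) (use pdw null F that in simp_all)
  then have fr: "null_frame (\<xi> p) (\<eta> p) (n1 p) (n2 p)" if "p \<in> D" for p
    using geo that null[OF that]
    by (auto simp: geometric_frame_field_def null_frame_def n1_def mink_commute[of "\<xi> p" "geo_n1 w p"]
        mink_commute[of "\<eta> p" "geo_n1 w p"] mink_commute[of "\<xi> p" "n2 p"] mink_commute[of "\<eta> p" "n2 p"])
  note mk = null_frame_mink[OF fr]
  note [simp] = fnz F(2)
  define \<nu>' where "\<nu>' = geo_nu w"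
  have f': "\<forall>p\<in>D. f p > 0" and pdw': "\<forall>p\<in>D. has_pd w (\<xi> p) ((f p)\<^sup>2 *\<^sub>R \<eta> p) p"
    using f pdw by (auto simp: F_def)
  note pd\<xi> = smooth_on_has_pd[OF sm\<xi>] and pd\<eta> = smooth_on_has_pd[OF sm\<eta>] and pdn2 = smooth_on_has_pd[OF smn2]
  have np: "nproj (\<xi> p) (\<eta> p) (pd_u \<xi> p) = (F p * lam1 p) *\<^sub>R n1 p + (F p * mu1 p) *\<^sub>R n2 p"
    "nproj (\<xi> p) (\<eta> p) (pd_u \<eta> p) = - \<nu>' p *\<^sub>R n1 p"
    "nproj (\<xi> p) (\<eta> p) (pd_v \<eta> p) = 0" if p: "p \<in> D" for p
  proof -
    note isf = isotropic_second_fund[OF \<open>open D\<close> p f(1) f' pdw' pd\<xi>[OF p] pd\<eta>[OF p] null[OF p]]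
    have "(1 / F p) *\<^sub>R nproj (\<xi> p) (\<eta> p) (pd_u \<xi> p) = lam1 p *\<^sub>R n1 p + mu1 p *\<^sub>R n2 p"
      using ass p unfolding associated_functions_def isf(1)[symmetric] F_def n1_def by blast
    then have "F p *\<^sub>R (1 / F p) *\<^sub>R nproj (\<xi> p) (\<eta> p) (pd_u \<xi> p) = F p *\<^sub>R (lam1 p *\<^sub>R n1 p + mu1 p *\<^sub>R n2 p)"
      by simp
    then show "nproj (\<xi> p) (\<eta> p) (pd_u \<xi> p) = (F p * lam1 p) *\<^sub>R n1 p + (F p * mu1 p) *\<^sub>R n2 p"
      using p by (simp add: scaleR_add_right)
    show "nproj (\<xi> p) (\<eta> p) (pd_u \<eta> p) = - \<nu>' p *\<^sub>R n1 p"
      using ass p unfolding associated_functions_def isf(2)[symmetric] \<nu>'_def n1_def by simp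
    \<comment> \<open>Being of third type is asserted for some normal field \<open>m2\<close>,
      possibly another one than \<open>n2\<close>. What transfers is the vector equation
      \<sigma>(y,y) = 0, which involves neither.\<close>
    obtain m2 l1 k1 l2 k2 where "associated_functions D f w m2 l1 k1 l2 k2" "\<forall>p\<in>D. k2 p = 0 \<and> l2 p = 0"
      using tt unfolding third_type_surface_def by blast
    then show "nproj (\<xi> p) (\<eta> p) (pd_v \<eta> p) = 0"
      using p unfolding associated_functions_def isf(3)[symmetric] by simp
  qed
  define \<kappa> where "\<kappa> = (\<lambda>p. mink (mean_curvature w p) (mean_curvature w p))"
  \<comment> \<open>Positivity is not part of the definition of \<open>geo_nu\<close>. It follows
    from <n1,n1> = 1: a zero value would make n1 = 0, since 1 / 0 = 0, and otherwise <H,H> is a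
    nonzero square.\<close>
  have \<nu>'_pos: "\<nu>' p > 0" if "p \<in> D" for p
  proof -
    have n: "n1 p = (1 / \<nu>' p) *\<^sub>R mean_curvature w p" by (simp add: n1_def geo_n1_def \<nu>'_def)
    have 1: "(1 / \<nu>' p) * ((1 / \<nu>' p) * \<kappa> p) = 1"
      using mk(5)[OF that] unfolding n mink.scaleR_left mink.scaleR_right \<kappa>_def by auto
    then have "\<nu>' p \<noteq> 0" by auto
    with 1 have "\<kappa> p = \<nu>' p * \<nu>' p" by (simp add: field_simps)
    with \<open>\<nu>' p \<noteq> 0\<close> have "\<kappa> p > 0" by (auto simp: zero_less_mult_iff linorder_neq_iff)
    then show ?thesis by (simp add: \<nu>'_def geo_nu_def \<kappa>_def)
  qed
  \<comment> \<open>An explicit expression for the mean curvature, free of definite descriptions and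
    built from smooth fields. It yields smoothness of \<open>\<nu>'\<close> and
    \<open>n1\<close>.\<close>
  define H where "H = (\<lambda>p. - (pd_u \<eta> p + mink (pd_u \<eta> p) (\<eta> p) *\<^sub>R \<xi> p + mink (pd_u \<eta> p) (\<xi> p) *\<^sub>R \<eta> p))"
  have smH: "smooth_on H D"
    unfolding H_def
    by (intro smooth_on_minus smooth_on_add smooth_on_scaleR smooth_on_mink smooth_on_pd_u sm\<xi> sm\<eta> \<open>open D\<close>)
  have H: "H p = \<nu>' p *\<^sub>R n1 p" if "p \<in> D" for p
  proof -
    have "H p = - nproj (\<xi> p) (\<eta> p) (pd_u \<eta> p)" by (simp add: H_def nproj_def)
    then show ?thesis using np(2)[OF that] by simp
  qed
  have HH: "mink (H p) (H p) = \<nu>' p * \<nu>' p" if "p \<in> D" for p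
    using mk(5)[OF that] by (simp add: H that mink_simps)
  have HHpos: "mink (H p) (H p) > 0" if "p \<in> D" for p
    using \<nu>'_pos[OF that] by (simp add: HH that)
  have sm\<nu>': "smooth_on \<nu>' D"
    by (rule smooth_on_cong[of "\<lambda>p. sqrt (mink (H p) (H p))"])
      (use \<nu>'_pos HHpos in \<open>auto intro!: smooth_on_sqrt smooth_on_mink smH \<open>open D\<close> simp: HH less_imp_le\<close>)
  have \<nu>'nz: "\<nu>' p \<noteq> 0" if "p \<in> D" for p using \<nu>'_pos[OF that] by simp
  have "smooth_on (\<lambda>p. (1 / \<nu>' p) *\<^sub>R H p) D"
    by (intro smooth_on_scaleR smooth_on_divide smooth_on_const smH sm\<nu>' \<open>open D\<close> \<nu>'nz)
  then have smn1: "smooth_on n1 D"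
    by (rule smooth_on_cong[OF _ \<open>open D\<close>]) (simp add: H \<nu>'nz)
  note pdn1 = smooth_on_has_pd[OF smn1]
  have pdF: "has_pd F (F p * L p) (F p * pd_v (ln_sq f) p) p" if "p \<in> D" for p
    using has_pd_sq[OF f(1) that \<open>open D\<close> f(2)] unfolding F_def L_def .
  have smL: "smooth_on L D"
    unfolding L_def by (intro smooth_on_pd_u smooth_on_ln_sq f \<open>open D\<close>)

  \<comment> \<open>This is w_uv = w_vu with w_v = F \<eta> and F_u = F L.\<close>
  have \<xi>v: "pd_v \<xi> p = F p *\<^sub>R pd_u \<eta> p + (F p * L p) *\<^sub>R \<eta> p" if p: "p \<in> D" for p
  proof -
    have "has_pd (pd_v w) (F p *\<^sub>R pd_u \<eta> p + (F p * L p) *\<^sub>R \<eta> p)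
        (F p *\<^sub>R pd_v \<eta> p + (F p * pd_v (ln_sq f) p) *\<^sub>R \<eta> p) p"
      by (rule has_pd_cong[OF has_pd_scaleR[OF pdF[OF p] pd\<eta>[OF p]] \<open>open D\<close> p]) (simp add: wv)
    then show ?thesis
      using pd_commute[OF \<open>open D\<close> sm p] has_pd_unique(1) by (metis \<xi>_def)
  qed
  have dm: "mink (a p) (pd_u b p) = - mink (b p) (pd_u a p)" "mink (a p) (pd_v b p) = - mink (b p) (pd_v a p)"
    if "smooth_on a D" "smooth_on b D" "\<And>p. p \<in> D \<Longrightarrow> mink (a p) (b p) = k" "p \<in> D"
    for a b :: "real \<times> real \<Rightarrow> real^4" and k p
    using has_pd_const_on[OF mink.has_pd[OF smooth_on_has_pd[OF that(1,4)] smooth_on_has_pd[OF that(2,4)]]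
        \<open>open D\<close> that(4), of k] that(3)
    by (simp_all add: mink_commute[of _ "b p"])
  have \<eta>u: "pd_u \<eta> p = - L p *\<^sub>R \<eta> p - \<nu>' p *\<^sub>R n1 p"
    and \<xi>u: "pd_u \<xi> p = L p *\<^sub>R \<xi> p + (F p * lam1 p) *\<^sub>R n1 p + (F p * mu1 p) *\<^sub>R n2 p"
    and \<eta>v: "pd_v \<eta> p = 0"
    and \<xi>v': "pd_v \<xi> p = - (F p * \<nu>' p) *\<^sub>R n1 p" if p: "p \<in> D" for p
  proof -
    have \<xi>\<xi>: "mink (pd_u \<xi> p) (\<xi> p) = 0" "mink (pd_v \<xi> p) (\<xi> p) = 0"
      using dm[OF sm\<xi> sm\<xi> null(1) p] by (simp_all add: mink_commute)
    have \<eta>\<eta>: "mink (pd_u \<eta> p) (\<eta> p) = 0" "mink (pd_v \<eta> p) (\<eta> p) = 0"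
      using dm[OF sm\<eta> sm\<eta> null(2) p] by (simp_all add: mink_commute)
    \<comment> \<open>As \<xi> stays null, the left side is 0, which forces <\<eta>_u, \<xi>> =
      L.\<close>
    have "mink (pd_v \<xi> p) (\<xi> p) = F p * (mink (pd_u \<eta> p) (\<xi> p) - L p)"
      unfolding \<xi>v[OF p] by (simp add: mink_simps mk[OF p] algebra_simps)
    then have L: "mink (pd_u \<eta> p) (\<xi> p) = L p"
      using \<xi>\<xi> p by simp
    then have L': "mink (pd_u \<xi> p) (\<eta> p) = - L p"
      using dm(1)[OF sm\<xi> sm\<eta> null(3) p] by (simp add: mink_commute)
    have "mink (pd_v \<xi> p) (\<eta> p) = 0"
      unfolding \<xi>v[OF p] by (simp add: mink_simps mk[OF p] \<eta>\<eta>)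
    then have v: "mink (pd_v \<eta> p) (\<xi> p) = 0"
      using dm(2)[OF sm\<xi> sm\<eta> null(3) p] by (simp add: mink_commute)
    show \<eta>u: "pd_u \<eta> p = - L p *\<^sub>R \<eta> p - \<nu>' p *\<^sub>R n1 p"
    proof -
      have "pd_u \<eta> p + L p *\<^sub>R \<eta> p = - \<nu>' p *\<^sub>R n1 p"
        using np(2)[OF p] by (simp add: nproj_def \<eta>\<eta> L)
      then have "pd_u \<eta> p = - \<nu>' p *\<^sub>R n1 p - L p *\<^sub>R \<eta> p" by (simp add: eq_diff_eq)
      then show ?thesis by simp
    qed
    show "pd_u \<xi> p = L p *\<^sub>R \<xi> p + (F p * lam1 p) *\<^sub>R n1 p + (F p * mu1 p) *\<^sub>R n2 p"
      using np(1)[OF p] by (simp add: nproj_def \<xi>\<xi> L' algebra_simps)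
    show "pd_v \<eta> p = 0"
      using np(3)[OF p] by (simp add: nproj_def \<eta>\<eta> v)
    show "pd_v \<xi> p = - (F p * \<nu>' p) *\<^sub>R n1 p"
      unfolding \<xi>v[OF p] \<eta>u by (simp add: algebra_simps)
  qed
  have eqs: "pd_u n1 p = - \<nu>' p *\<^sub>R \<xi> p + (F p * lam1 p) *\<^sub>R \<eta> p + c p *\<^sub>R n2 p"
    "pd_v n1 p = - (F p * \<nu>' p) *\<^sub>R \<eta> p"
    "pd_u n2 p = (F p * mu1 p) *\<^sub>R \<eta> p - c p *\<^sub>R n1 p" "pd_v n2 p = 0"
    and \<nu>': "\<nu>' p = \<nu> p" if p: "p \<in> D" for p
  proof -
    \<comment> \<open>The normal connection coefficients in the u and v directions, the only
      components of the derivatives of n1 and n2 still unknown.\<close>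
    define c' d where "c' = mink (pd_u n1 p) (n2 p)" and "d = mink (pd_v n1 p) (n2 p)"
    note d1 = dm[OF smn1 sm\<xi> mk(10) p] dm[OF smn1 sm\<eta> mk(14) p] dm[OF smn1 smn1 mk(5) p]
    note d2 = dm[OF smn2 sm\<xi> mk(12) p] dm[OF smn2 sm\<eta> mk(16) p] dm[OF smn2 smn2 mk(6) p]
      dm[OF smn1 smn2 mk(7) p]
    have n1: "mink (pd_u n1 p) (\<xi> p) = - (F p * lam1 p)" "mink (pd_u n1 p) (\<eta> p) = \<nu>' p"
      "mink (pd_u n1 p) (n1 p) = 0" "mink (pd_v n1 p) (\<xi> p) = F p * \<nu>' p"
      "mink (pd_v n1 p) (\<eta> p) = 0" "mink (pd_v n1 p) (n1 p) = 0"
      using d1 by (simp_all add: \<xi>u \<xi>v' \<eta>u \<eta>v p mink_simps mk[OF p] mink_commute[of _ "pd_u n1 p"]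
          mink_commute[of _ "pd_v n1 p"])
    have n2: "mink (pd_u n2 p) (\<xi> p) = - (F p * mu1 p)" "mink (pd_u n2 p) (\<eta> p) = 0"
      "mink (pd_u n2 p) (n2 p) = 0" "mink (pd_u n2 p) (n1 p) = - c'" "mink (pd_v n2 p) (\<xi> p) = 0"
      "mink (pd_v n2 p) (\<eta> p) = 0" "mink (pd_v n2 p) (n2 p) = 0" "mink (pd_v n2 p) (n1 p) = - d"
      using d2 by (simp_all add: \<xi>u \<xi>v' \<eta>u \<eta>v p mink_simps mk[OF p] mink_commute[of _ "pd_u n2 p"]
          mink_commute[of _ "pd_v n2 p"] mink_commute[of "n2 p" "pd_u n1 p"]
          mink_commute[of "n2 p" "pd_v n1 p"] c'_def d_def)
    have n1u: "pd_u n1 p = - \<nu>' p *\<^sub>R \<xi> p + (F p * lam1 p) *\<^sub>R \<eta> p + c' *\<^sub>R n2 p"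
      using null_frame_expansion[OF fr[OF p], of "pd_u n1 p"] by (simp add: n1 c'_def)
    have n1v: "pd_v n1 p = - (F p * \<nu>' p) *\<^sub>R \<eta> p + d *\<^sub>R n2 p"
      using null_frame_expansion[OF fr[OF p], of "pd_v n1 p"] by (simp add: n1 d_def)
    have n2u: "pd_u n2 p = (F p * mu1 p) *\<^sub>R \<eta> p - c' *\<^sub>R n1 p"
      using null_frame_expansion[OF fr[OF p], of "pd_u n2 p"] by (simp add: n2)
    have n2v: "pd_v n2 p = - d *\<^sub>R n1 p"
      using null_frame_expansion[OF fr[OF p], of "pd_v n2 p"] by (simp add: n2)
    note pdL = smooth_on_has_pd[OF smL p] and pd\<nu>' = smooth_on_has_pd[OF sm\<nu>' p]
    \<comment> \<open>Integrability of \<eta>: since \<eta>_v = 0, the v-derivative of \<eta>_u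
      vanishes. Its product with \<xi> is the Gauss equation L_v = F \<nu>'^2, its product with n2
      gives d = 0.\<close>
    have "has_pd (\<lambda>p. - L p *\<^sub>R \<eta> p - \<nu>' p *\<^sub>R n1 p)
        (- L p *\<^sub>R pd_u \<eta> p + - pd_u L p *\<^sub>R \<eta> p - (\<nu>' p *\<^sub>R pd_u n1 p + pd_u \<nu>' p *\<^sub>R n1 p))
        (- L p *\<^sub>R pd_v \<eta> p + - pd_v L p *\<^sub>R \<eta> p - (\<nu>' p *\<^sub>R pd_v n1 p + pd_v \<nu>' p *\<^sub>R n1 p)) p"
      by (rule pd_intros pdL pd\<nu>' pdn1 pd\<eta> p)+
    from has_pd_unique(2)[OF has_pd_cong[OF this \<open>open D\<close> p, of "pd_u \<eta>"]]
    have "pd_v (pd_u \<eta>) p = - pd_v L p *\<^sub>R \<eta> p - (\<nu>' p *\<^sub>R pd_v n1 p + pd_v \<nu>' p *\<^sub>R n1 p)"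
      by (simp add: \<eta>u \<eta>v p)
    moreover have "pd_u (pd_v \<eta>) p = 0"
      using has_pd_unique(1)[OF has_pd_cong[OF has_pd_const \<open>open D\<close> p, of 0 "pd_v \<eta>"]] by (simp add: \<eta>v)
    ultimately have "- pd_v L p *\<^sub>R \<eta> p - (\<nu>' p *\<^sub>R pd_v n1 p + pd_v \<nu>' p *\<^sub>R n1 p) = 0"
      using pd_commute[OF \<open>open D\<close> sm\<eta> p] by simp
    then have *: "mink (- pd_v L p *\<^sub>R \<eta> p - (\<nu>' p *\<^sub>R pd_v n1 p + pd_v \<nu>' p *\<^sub>R n1 p)) a = 0" for a
      by (simp add: mink_simps)
    have Lv: "pd_v L p = F p * (\<nu>' p)\<^sup>2"
      using *[of "\<xi> p"] by (simp add: mink_simps mk[OF p] n1 power2_eq_square)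
    have d0: "d = 0"
      using *[of "n2 p"] \<nu>'nz[OF p] by (simp add: mink_simps mk[OF p] n1v)
    have "sqrt (pd_v L p) = f p * \<nu>' p"
      using Lv f(2)[OF p] \<nu>'_pos[OF p] by (simp add: F_def real_sqrt_mult)
    then show \<nu>': "\<nu>' p = \<nu> p" using p by (simp add: \<nu>_def)
    have sm\<beta>: "smooth_on (\<lambda>p. F p * mu1 p) D" and sm\<alpha>: "smooth_on (\<lambda>p. F p * lam1 p) D"
      by (intro smooth_on_mult smF mu1 lam1 \<open>open D\<close>)+
    note pd\<beta> = smooth_on_has_pd[OF sm\<beta> p] and pd\<alpha> = smooth_on_has_pd[OF sm\<alpha> p]
    \<comment> \<open>Integrability of \<xi>, of which only the n2-component is used: it reads
      \<beta>_v = -F \<nu>' c' with \<beta> = F mu1, the Codazzi equation that determines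
      c'.\<close>
    have "has_pd (\<lambda>p. L p *\<^sub>R \<xi> p + (F p * lam1 p) *\<^sub>R n1 p + (F p * mu1 p) *\<^sub>R n2 p)
        (L p *\<^sub>R pd_u \<xi> p + pd_u L p *\<^sub>R \<xi> p
          + ((F p * lam1 p) *\<^sub>R pd_u n1 p + pd_u (\<lambda>p. F p * lam1 p) p *\<^sub>R n1 p)
          + ((F p * mu1 p) *\<^sub>R pd_u n2 p + pd_u (\<lambda>p. F p * mu1 p) p *\<^sub>R n2 p))
        (L p *\<^sub>R pd_v \<xi> p + pd_v L p *\<^sub>R \<xi> p
          + ((F p * lam1 p) *\<^sub>R pd_v n1 p + pd_v (\<lambda>p. F p * lam1 p) p *\<^sub>R n1 p)
          + ((F p * mu1 p) *\<^sub>R pd_v n2 p + pd_v (\<lambda>p. F p * mu1 p) p *\<^sub>R n2 p)) p"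
      by (intro has_pd_add has_pd_scaleR pdL pd\<xi> pd\<alpha> pd\<beta> pdn1 pdn2 p)
    from has_pd_unique(2)[OF has_pd_cong[OF this \<open>open D\<close> p, of "pd_u \<xi>"]]
    have "mink (pd_v (pd_u \<xi>) p) (n2 p) = pd_v (\<lambda>p. F p * mu1 p) p"
      by (simp add: \<xi>u mink_simps mk[OF p] \<xi>v'[OF p] n1v n2v d0)
    moreover
    have "has_pd (\<lambda>p. - (F p * \<nu>' p) *\<^sub>R n1 p)
        (- (F p * \<nu>' p) *\<^sub>R pd_u n1 p + - (F p * pd_u \<nu>' p + (F p * L p) * \<nu>' p) *\<^sub>R n1 p)
        (- (F p * \<nu>' p) *\<^sub>R pd_v n1 p + - (F p * pd_v \<nu>' p + (F p * pd_v (ln_sq f) p) * \<nu>' p) *\<^sub>R n1 p) p"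
      by (intro has_pd_scaleR has_pd_minus has_pd_mult pd\<nu>' pdF pdn1 p)
    from has_pd_unique(1)[OF has_pd_cong[OF this \<open>open D\<close> p, of "pd_v \<xi>"]]
    have "mink (pd_u (pd_v \<xi>) p) (n2 p) = - (F p * \<nu>' p) * c'"
      by (simp add: \<xi>v' mink_simps mk[OF p] c'_def)
    ultimately have "pd_v (\<lambda>p. F p * mu1 p) p = - (F p * \<nu>' p) * c'"
      using pd_commute[OF \<open>open D\<close> sm\<xi> p] by simp
    then have c': "c' = c p"
      using \<nu>'nz[OF p] F(2)[OF p] unfolding c_def \<nu>'[symmetric] F_def by simp
    show "pd_u n1 p = - \<nu>' p *\<^sub>R \<xi> p + (F p * lam1 p) *\<^sub>R \<eta> p + c p *\<^sub>R n2 p"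
      "pd_v n1 p = - (F p * \<nu>' p) *\<^sub>R \<eta> p"
      "pd_u n2 p = (F p * mu1 p) *\<^sub>R \<eta> p - c p *\<^sub>R n1 p" "pd_v n2 p = 0"
      by (simp_all add: n1u n1v n2u n2v c' d0)
  qed
  have "frame_system D F L \<nu> (\<lambda>p. F p * lam1 p) (\<lambda>p. F p * mu1 p) c \<xi> \<eta> n1 n2"
    unfolding frame_system_def
  proof (intro ballI conjI)
    fix p assume p: "p \<in> D"
    show "has_pd \<xi> (L p *\<^sub>R \<xi> p + (F p * lam1 p) *\<^sub>R n1 p + (F p * mu1 p) *\<^sub>R n2 p) (- (F p * \<nu> p) *\<^sub>R n1 p) p"
      using pd\<xi>[OF p] unfolding \<xi>u[OF p] \<xi>v'[OF p] \<nu>'[OF p] .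
    show "has_pd \<eta> (- L p *\<^sub>R \<eta> p - \<nu> p *\<^sub>R n1 p) 0 p"
      using pd\<eta>[OF p] unfolding \<eta>u[OF p] \<eta>v[OF p] \<nu>'[OF p] .
    show "has_pd n1 (- \<nu> p *\<^sub>R \<xi> p + (F p * lam1 p) *\<^sub>R \<eta> p + c p *\<^sub>R n2 p) (- (F p * \<nu> p) *\<^sub>R \<eta> p) p"
      using pdn1[OF p] unfolding eqs(1)[OF p] eqs(2)[OF p] \<nu>'[OF p] .
    show "has_pd n2 ((F p * mu1 p) *\<^sub>R \<eta> p - c p *\<^sub>R n1 p) 0 p"
      using pdn2[OF p] unfolding eqs(3)[OF p] eqs(4)[OF p] .
  qed
  moreover have "\<xi> q = f q *\<^sub>R x0" "\<eta> q = (1 / f q) *\<^sub>R y0"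
    using fnz[OF D] by (simp_all add: init[symmetric] geo_x_def geo_y_def \<xi>_def \<eta>_def F_def power2_eq_square)
  ultimately show thesis
    using that[of \<xi> \<eta> n1 n2] pdw wq init unfolding F_def n1_def by blast
qed

section \<open>Existence of solutions\<close>

text \<open>By joint continuity \<open>A\<close> is bounded on the compact set {a..b} x unit sphere.
  Homogeneity turns this bound into a Lipschitz constant that is uniform in t.\<close>

lemma linear_ode_local:
  fixes A :: "real \<Rightarrow> 'a::euclidean_space \<Rightarrow> 'a"
  assumes t0: "a < t0" "t0 < b"
    and cont: "continuous_on ({a..b} \<times> UNIV) (\<lambda>(t, x). A t x)"
    and lin: "\<And>t. linear (A t)"
  obtains d \<phi> where "d > 0" "{t0 - d..t0 + d} \<subseteq> {a..b}" "\<phi> t0 = x0"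
    "\<And>t. t \<in> {t0 - d<..<t0 + d} \<Longrightarrow> (\<phi> has_vector_derivative A t (\<phi> t)) (at t)"
proof -
  have "compact ((\<lambda>(t, x). A t x) ` ({a..b} \<times> sphere 0 1))"
    by (intro compact_continuous_image compact_Times compact_Icc compact_sphere
        continuous_on_subset[OF cont]) auto
  then have "bounded ((\<lambda>(t, x). A t x) ` ({a..b} \<times> sphere 0 1))"
    by (rule compact_imp_bounded)
  then obtain K where K': "\<forall>y\<in>(\<lambda>(t, x). A t x) ` ({a..b} \<times> sphere 0 1). norm y \<le> K"
    unfolding bounded_iff by blast
  have K: "norm (A t x) \<le> K" if "t \<in> {a..b}" "norm x = 1" for t x
    using K' that by (force simp: image_iff)
  have bnd: "norm (A t x) \<le> K * norm x" if t: "t \<in> {a..b}" for t x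
  proof (cases "x = 0")
    case True
    then show ?thesis by (simp add: linear_0[OF lin])
  next
    case False
    then have "norm (A t ((1 / norm x) *\<^sub>R x)) \<le> K" by (intro K t) simp
    then show ?thesis using False by (simp add: linear_scale[OF lin] field_simps)
  qed
  show thesis
  proof (rule picard_local[OF t0 cont])
    show "norm (A t x - A t y) \<le> K * norm (x - y)" if "t \<in> {a..b}" for t x y
      using bnd[OF that, of "x - y"] by (simp add: linear_diff[OF lin])
  qed (use that in blast)
qed

lemma has_pd_fst:
  assumes "(g has_vector_derivative g') (at (fst p))"
  shows "has_pd (\<lambda>p. g (fst p)) g' 0 p"
  using has_derivative_compose[OF has_derivative_fst[OF has_derivative_ident] assms[unfolded has_vector_derivative_def]]
  by (simp add: has_pd_def)

text \<open>Bootstrapping step for solutions that depend on u only: a right-hand side of class k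
  makes the solution of class k + 1.\<close>

lemma ck_on_Suc_pd:
  assumes "open S" "\<And>p. p \<in> S \<Longrightarrow> has_pd g (gu p) 0 p" "ck_on k gu S"
  shows "ck_on (Suc k) g S"
proof (rule ck_on_SucI[OF assms(1)])
  show "(g has_derivative (\<lambda>h. fst h *\<^sub>R gu p)) (at p)" if "p \<in> S" for p
    using assms(2)[OF that] by (simp add: has_pd_def)
  show "ck_on k (\<lambda>p. fst h *\<^sub>R gu p) S" for h
    by (intro bounded_bilinear.ck_on[OF bounded_bilinear_scaleR] ck_on_const assms)
qed

section \<open>Reduction of the structure equations to a linear equation in u\<close>

locale third_type_data =
  fixes D :: "(real \<times> real) set" and f lam1 mu1 :: "real \<times> real \<Rightarrow> real"
  assumes D: "open D"
    and smooth: "smooth_on f D" "smooth_on lam1 D" "smooth_on mu1 D"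
    and f_pos: "\<And>p. p \<in> D \<Longrightarrow> f p > 0"
    and pos: "\<And>p. p \<in> D \<Longrightarrow> pd_v (pd_u (ln_sq f)) p > 0"
    and i: "\<And>p. p \<in> D \<Longrightarrow> pd_v (\<lambda>q. pd_v (pd_u (ln_sq f)) q / (f q)\<^sup>2) p = 0"
    and ii: "\<And>p. p \<in> D \<Longrightarrow> pd_v lam1 p + lam1 p * pd_v (ln_sq f) p
                 + pd_u (\<lambda>q. sqrt (pd_v (pd_u (ln_sq f)) q) / f q) p = 0"
    and iii: "\<And>p. p \<in> D \<Longrightarrow>
      pd_v (pd_v mu1) p + pd_v mu1 p * pd_v (ln_sq f) p + mu1 p * pd_v (pd_v (ln_sq f)) p = 0"
begin

definition F where "F p = (f p)\<^sup>2"
definition L where "L = pd_u (ln_sq f)"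
definition \<nu> where "\<nu> p = sqrt (pd_v L p) / f p"
definition \<beta> where "\<beta> p = F p * mu1 p"
definition c where "c p = - pd_v \<beta> p / (F p * \<nu> p)"

text \<open>\<open>\<kappa>\<close>, \<open>\<rho>\<close> and \<open>\<tau>\<close> arise as the coefficients of the system in \<open>u\<close> for the fields \<open>\<eta>\<close>, \<open>M = n\<^sub>1 + s \<eta>\<close>,
  \<open>\<Xi> = \<xi> + s n\<^sub>1 + s\<^sup>2/2 \<eta>\<close>, \<open>n\<^sub>2\<close> and \<open>z - (s/\<nu>) \<eta>\<close>.\<close>

definition s where "s p = L p / \<nu> p"
definition \<kappa> where "\<kappa> p = \<beta> p + c p * s p"
definition \<rho> where "\<rho> p = F p * lam1 p + pd_u s p - \<nu> p * ((s p)\<^sup>2 / 2)"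
definition \<tau> where "\<tau> p = (s p)\<^sup>2 / 2 - pd_u (\<lambda>p. s p / \<nu> p) p"

lemma F_nz: "p \<in> D \<Longrightarrow> F p \<noteq> 0" and f_nz: "p \<in> D \<Longrightarrow> f p \<noteq> 0"
  using f_pos[of p] by (simp_all add: F_def)

lemma \<nu>_pos: "p \<in> D \<Longrightarrow> \<nu> p > 0" and \<nu>_nz: "p \<in> D \<Longrightarrow> \<nu> p \<noteq> 0"
  using f_pos[of p] pos[of p] by (simp_all add: \<nu>_def L_def)

lemma smooth_ln_sq: "smooth_on (ln_sq f) D"
  by (rule smooth_on_ln_sq[OF D smooth(1) f_pos])

lemma smooth_L: "smooth_on L D"
  unfolding L_def by (intro smooth_on_pd_u D smooth_ln_sq)

lemma smooth_F: "smooth_on F D"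
  unfolding F_def[abs_def] by (intro smooth_on_power2 D smooth)

lemma smooth_\<nu>: "smooth_on \<nu> D"
  unfolding \<nu>_def[abs_def]
  by (intro smooth_on_divide smooth_on_sqrt smooth_on_pd_v D smooth smooth_L f_nz)
    (simp add: L_def pos)

lemma smooth_\<beta>: "smooth_on \<beta> D"
  unfolding \<beta>_def[abs_def] by (intro smooth_on_mult D smooth smooth_F)

lemma smooth_c: "smooth_on c D"
  unfolding c_def[abs_def]
  by (intro smooth_on_divide smooth_on_minus smooth_on_mult smooth_on_pd_v D smooth_\<beta> smooth_F smooth_\<nu>)
    (simp add: F_nz \<nu>_nz)

lemma smooth_s: "smooth_on s D"
  unfolding s_def[abs_def] by (intro smooth_on_divide D smooth_L smooth_\<nu> \<nu>_nz)

lemma smooth_s_\<nu>: "smooth_on (\<lambda>p. s p / \<nu> p) D"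
  by (intro smooth_on_divide D smooth_s smooth_\<nu> \<nu>_nz)

lemma smooth_\<kappa>: "smooth_on \<kappa> D"
  unfolding \<kappa>_def[abs_def] by (intro smooth_intros D smooth_\<beta> smooth_c smooth_s)

lemma smooth_\<rho>: "smooth_on \<rho> D"
  unfolding \<rho>_def[abs_def]
  by (intro smooth_intros smooth_on_pd_u D smooth_F smooth smooth_s smooth_\<nu>) simp

lemma smooth_\<tau>: "smooth_on \<tau> D"
  unfolding \<tau>_def[abs_def] by (intro smooth_on_diff smooth_on_divide smooth_on_power2 smooth_on_const
    smooth_on_pd_u D smooth_s smooth_s_\<nu>) simp

lemma pd_F: "p \<in> D \<Longrightarrow> has_pd F (F p * L p) (F p * pd_v (ln_sq f) p) p"
  using has_pd_sq[OF smooth(1) _ D f_pos] unfolding F_def[abs_def] L_def .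

lemma L_eq: "p \<in> D \<Longrightarrow> L p = \<nu> p * s p"
  using \<nu>_nz by (simp add: s_def)

lemma Lv: "p \<in> D \<Longrightarrow> pd_v L p = F p * (\<nu> p)\<^sup>2"
  using f_nz[of p] pos[of p] by (simp add: \<nu>_def F_def L_def power_divide)

text \<open>Condition (i) states that \<nu>^2 = L_v / F has zero v-derivative; positivity allows the
  root to be taken.\<close>

lemma pd_\<nu>: assumes p: "p \<in> D" shows "has_pd \<nu> (pd_u \<nu> p) 0 p"
proof -
  define g where "g = (\<lambda>q. pd_v L q / (f q)\<^sup>2)"
  have gpos: "g p > 0" using pos[OF p] f_nz[OF p] by (simp add: g_def L_def)
  have "smooth_on g D" unfolding g_def
    by (intro smooth_on_divide smooth_on_pd_v smooth_L smooth_on_power2 smooth D) (simp add: f_nz)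
  from smooth_on_has_pd[OF this p] have "has_pd g (pd_u g p) 0 p"
    using i[OF p] by (simp add: g_def L_def)
  from has_pd_compose[OF this DERIV_real_sqrt[OF gpos]]
  have "has_pd (\<lambda>q. sqrt (g q)) (inverse (sqrt (g p)) / 2 * pd_u g p) 0 p" by simp
  from has_pd_cong[OF this D p, of \<nu>]
  have "has_pd \<nu> (inverse (sqrt (g p)) / 2 * pd_u g p) 0 p"
    using f_pos by (simp add: g_def \<nu>_def real_sqrt_divide less_imp_le)
  then show ?thesis using has_pd_unique(1) by metis
qed

text \<open>With \<nu>_v = 0 the quotient rule leaves L_v / \<nu> = F \<nu>.\<close>

lemma pd_s: assumes p: "p \<in> D" shows "has_pd s (pd_u s p) (F p * \<nu> p) p"
proof -
  have "has_pd s ((pd_u L p * \<nu> p - L p * pd_u \<nu> p) / (\<nu> p)\<^sup>2) ((pd_v L p * \<nu> p - L p * 0) / (\<nu> p)\<^sup>2) p"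
    unfolding s_def[abs_def]
    by (intro has_pd_divide smooth_on_has_pd[OF smooth_L] pd_\<nu> p \<nu>_nz)
  from has_pd_unique(1)[OF this] show ?thesis
    by (intro has_pd_eq_rhs[OF \<open>has_pd s _ _ p\<close>])
      (use \<nu>_nz[OF p] in \<open>simp_all add: Lv[OF p] power2_eq_square\<close>)
qed

lemma pd_s_\<nu>: assumes p: "p \<in> D" shows "has_pd (\<lambda>p. s p / \<nu> p) (pd_u (\<lambda>p. s p / \<nu> p) p) (F p) p"
proof -
  have *: "has_pd (\<lambda>p. s p / \<nu> p) ((pd_u s p * \<nu> p - s p * pd_u \<nu> p) / (\<nu> p)\<^sup>2)
      ((F p * \<nu> p * \<nu> p - s p * 0) / (\<nu> p)\<^sup>2) p"
    by (intro has_pd_divide pd_s pd_\<nu> p \<nu>_nz)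
  from has_pd_unique(1)[OF this] show ?thesis
    by (intro has_pd_eq_rhs[OF *]) (use \<nu>_nz[OF p] in \<open>simp_all add: power2_eq_square\<close>)
qed

lemma \<beta>_v: assumes p: "p \<in> D" shows "pd_v \<beta> p = F p * (pd_v mu1 p + mu1 p * pd_v (ln_sq f) p)"
  unfolding \<beta>_def[abs_def]
  using has_pd_unique(2)[OF has_pd_mult[OF pd_F[OF p] smooth_on_has_pd[OF smooth(3) p]]]
  by (simp add: algebra_simps)

text \<open>After cancelling F one has c = h / \<nu>, and condition (iii) is exactly h_v =
  0.\<close>

lemma c_v: assumes p: "p \<in> D" shows "pd_v c p = 0"
proof -
  define h where "h q = - (pd_v mu1 q + mu1 q * pd_v (ln_sq f) q)" for q
  have *: "has_pd h (- (pd_u (pd_v mu1) p + (mu1 p * pd_u (pd_v (ln_sq f)) p + pd_u mu1 p * pd_v (ln_sq f) p)))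
      (- (pd_v (pd_v mu1) p + (mu1 p * pd_v (pd_v (ln_sq f)) p + pd_v mu1 p * pd_v (ln_sq f) p))) p"
    unfolding h_def[abs_def]
    by (intro has_pd_minus has_pd_add has_pd_mult smooth_on_has_pd[OF _ p] smooth_on_pd_v D smooth smooth_ln_sq)
  have "has_pd h (pd_u h p) 0 p"
    by (rule has_pd_eq_rhs[OF * has_pd_unique(1)[OF *, symmetric]]) (use iii[OF p] in simp)
  from has_pd_divide[OF this pd_\<nu>[OF p] \<nu>_nz[OF p]]
  have "pd_v (\<lambda>q. h q / \<nu> q) p = 0" by (simp add: has_pd_unique(2))
  moreover have "has_pd (\<lambda>q. h q / \<nu> q) (pd_u c p) (pd_v c p) p"
    by (rule has_pd_cong[OF smooth_on_has_pd[OF smooth_c p] D p])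
      (use F_nz in \<open>simp add: c_def h_def \<beta>_v minus_divide_left\<close>)
  ultimately show ?thesis using has_pd_unique(2) by metis
qed

text \<open>By its definition \<open>c\<close> satisfies \<beta>_v = -c F \<nu>, which cancels c
  s_v.\<close>

lemma \<kappa>_v: assumes p: "p \<in> D" shows "pd_v \<kappa> p = 0"
proof -
  have "has_pd c (pd_u c p) 0 p"
    using smooth_on_has_pd[OF smooth_c p] by (simp add: c_v[OF p])
  from has_pd_add[OF smooth_on_has_pd[OF smooth_\<beta> p] has_pd_mult[OF this pd_s[OF p]]]
  have "pd_v \<kappa> p = pd_v \<beta> p + (c p * (F p * \<nu> p) + 0 * s p)"
    unfolding \<kappa>_def[abs_def] by (rule has_pd_unique(2))
  then show ?thesis using F_nz[OF p] \<nu>_nz[OF p] by (simp add: c_def)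
qed

text \<open>The derivative is F times the left side of condition (ii). The extra term F L \<nu> in
  s_uv = (F \<nu>)_u cancels against \<nu> s s_v because L = \<nu> s.\<close>

lemma \<rho>_v: assumes p: "p \<in> D" shows "pd_v \<rho> p = 0"
proof -
  have "has_pd (pd_v s) (F p * pd_u \<nu> p + F p * L p * \<nu> p)
      (F p * 0 + F p * pd_v (ln_sq f) p * \<nu> p) p"
    by (rule has_pd_cong[OF has_pd_mult[OF pd_F[OF p] pd_\<nu>[OF p]] D p]) (simp add: has_pd_unique(2)[OF pd_s])
  then have "pd_v (pd_u s) p = F p * pd_u \<nu> p + F p * L p * \<nu> p"
    using pd_commute[OF D smooth_s p] by (simp add: has_pd_unique)
  moreover have "has_pd (pd_u s) (pd_u (pd_u s) p) (pd_v (pd_u s) p) p"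
    by (intro smooth_on_has_pd[OF _ p] smooth_on_pd_u D smooth_s)
  ultimately have su: "has_pd (pd_u s) (pd_u (pd_u s) p) (F p * pd_u \<nu> p + F p * L p * \<nu> p) p" by simp
  have "has_pd \<rho> (F p * pd_u lam1 p + F p * L p * lam1 p + pd_u (pd_u s) p
        - (\<nu> p * ((2 * s p * pd_u s p * 2 - (s p)\<^sup>2 * 0) / 2\<^sup>2) + pd_u \<nu> p * ((s p)\<^sup>2 / 2)))
      (F p * pd_v lam1 p + F p * pd_v (ln_sq f) p * lam1 p + (F p * pd_u \<nu> p + F p * L p * \<nu> p)
        - (\<nu> p * ((2 * s p * (F p * \<nu> p) * 2 - (s p)\<^sup>2 * 0) / 2\<^sup>2) + 0 * ((s p)\<^sup>2 / 2))) p"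
    unfolding \<rho>_def[abs_def]
    by (intro has_pd_diff has_pd_add has_pd_mult has_pd_divide has_pd_power2 has_pd_const pd_F su pd_s pd_\<nu> p
        smooth_on_has_pd[OF smooth(2)]) simp
  from has_pd_unique(2)[OF this]
  have "pd_v \<rho> p = F p * (pd_v lam1 p + lam1 p * pd_v (ln_sq f) p + pd_u \<nu> p)"
    by (simp add: L_eq[OF p] algebra_simps)
  also have "\<dots> = 0" using ii[OF p] unfolding \<nu>_def[abs_def] L_def by simp
  finally show ?thesis .
qed

text \<open>Both terms have v-derivative F L: s s_v = s F \<nu>, and (s / \<nu>)_uv = F_u.\<close>

lemma \<tau>_v: assumes p: "p \<in> D" shows "pd_v \<tau> p = 0"
proof -
  let ?g = "\<lambda>p. s p / \<nu> p"
  have "has_pd (pd_v ?g) (F p * L p) (F p * pd_v (ln_sq f) p) p"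
    by (rule has_pd_cong[OF pd_F[OF p] D p]) (simp add: has_pd_unique(2)[OF pd_s_\<nu>])
  then have "pd_v (pd_u ?g) p = F p * L p"
    using pd_commute[OF D smooth_s_\<nu> p] by (simp add: has_pd_unique)
  moreover have "has_pd (pd_u ?g) (pd_u (pd_u ?g) p) (pd_v (pd_u ?g) p) p"
    by (intro smooth_on_has_pd[OF _ p] smooth_on_pd_u D smooth_s_\<nu>)
  ultimately have gu: "has_pd (pd_u ?g) (pd_u (pd_u ?g) p) (F p * L p) p" by simp
  have "has_pd \<tau> ((2 * s p * pd_u s p * 2 - (s p)\<^sup>2 * 0) / 2\<^sup>2 - pd_u (pd_u ?g) p)
      ((2 * s p * (F p * \<nu> p) * 2 - (s p)\<^sup>2 * 0) / 2\<^sup>2 - F p * L p) p"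
    unfolding \<tau>_def[abs_def]
    by (intro has_pd_diff has_pd_divide has_pd_power2 has_pd_const gu pd_s p) simp
  from has_pd_unique(2)[OF this] show ?thesis
    by (simp add: L_eq[OF p] algebra_simps)
qed

lemma frame_system_exists:
  fixes p_q \<xi>_q \<eta>_q n1_q n2_q :: "real^4"
  assumes q: "(u0, v0) \<in> D"
  obtains D0 \<xi> \<eta> n1 n2 z
  where "planar_domain D0" "D0 \<subseteq> D" "(u0, v0) \<in> D0"
    and "frame_system D0 F L \<nu> (\<lambda>p. F p * lam1 p) \<beta> c \<xi> \<eta> n1 n2"
    and "smooth_on z D0" "\<And>p. p \<in> D0 \<Longrightarrow> has_pd z (\<xi> p) (F p *\<^sub>R \<eta> p) p" "smooth_on n2 D0"
    and "z (u0, v0) = p_q" "\<xi> (u0, v0) = \<xi>_q" "\<eta> (u0, v0) = \<eta>_q" "n1 (u0, v0) = n1_q" "n2 (u0, v0) = n2_q"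
proof -
  obtain e where e: "e > 0" "{u0 - e..u0 + e} \<times> {v0 - e..v0 + e} \<subseteq> D"
  proof -
    obtain A B where AB: "open A" "open B" "u0 \<in> A" "v0 \<in> B" "A \<times> B \<subseteq> D"
      using open_prod_elim[OF D q] by (metis mem_Sigma_iff)
    obtain e1 e2 where "e1 > 0" "cball u0 e1 \<subseteq> A" "e2 > 0" "cball v0 e2 \<subseteq> B"
      using AB open_contains_cball by metis
    moreover have "{u0 - min e1 e2..u0 + min e1 e2} \<subseteq> cball u0 e1"
      "{v0 - min e1 e2..v0 + min e1 e2} \<subseteq> cball v0 e2"
      by (auto simp: cball_eq_atLeastAtMost)
    ultimately have "{u0 - min e1 e2..u0 + min e1 e2} \<times> {v0 - min e1 e2..v0 + min e1 e2} \<subseteq> D"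
      using AB(5) by blast
    then show thesis
      using \<open>e1 > 0\<close> \<open>e2 > 0\<close> by (intro that[of "min e1 e2"]) auto
  qed
  \<comment> \<open>The u-equations of the v-constant fields, with coefficients taken on the line v
    = v0. The fifth component carries the position, so no separate integration of z is
    required.\<close>
  define A where "A t x = (case x of (\<Xi>, M, \<eta>, n, Z) \<Rightarrow>
     (\<rho> (t, v0) *\<^sub>R M + \<kappa> (t, v0) *\<^sub>R n,
      - \<nu> (t, v0) *\<^sub>R \<Xi> + \<rho> (t, v0) *\<^sub>R \<eta> + c (t, v0) *\<^sub>R n,
      - \<nu> (t, v0) *\<^sub>R M,
      \<kappa> (t, v0) *\<^sub>R \<eta> - c (t, v0) *\<^sub>R M,
      \<Xi> + \<tau> (t, v0) *\<^sub>R \<eta>))" for t and x :: "(real^4) \<times> (real^4) \<times> (real^4) \<times> (real^4) \<times> (real^4)"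
  have lin: "linear (A t)" for t
    by (rule linearI) (auto simp: A_def algebra_simps split: prod.splits)
  have co: "continuous_on ({u0 - e..u0 + e} \<times> UNIV) (\<lambda>x. g (fst x, v0))" if "smooth_on g D"
    for g :: "real \<times> real \<Rightarrow> real"
  proof (rule continuous_on_compose2[OF smooth_on_continuous[OF that]])
    show "continuous_on ({u0 - e..u0 + e} \<times> UNIV) (\<lambda>x. (fst x, v0))" by (intro continuous_intros)
    show "(\<lambda>x. (fst x, v0)) ` ({u0 - e..u0 + e} \<times> UNIV) \<subseteq> D" using e by auto
  qed
  have cont: "continuous_on ({u0 - e..u0 + e} \<times> UNIV) (\<lambda>(t, x). A t x)"
    unfolding A_def case_prod_beta
    by (intro continuous_intros co smooth_\<rho> smooth_\<kappa> smooth_\<nu> smooth_c smooth_\<tau>)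
  let ?q = "(u0, v0)"
  \<comment> \<open>The initial values of M and \<Xi> are the prescribed frame after the change of
    fields at the base point. Written with M instead of n1, \<Xi> = \<xi> + s M - (s^2 / 2) \<eta>,
    which accounts for the minus sign.\<close>
  define M0 where "M0 = n1_q + s ?q *\<^sub>R \<eta>_q"
  define \<Xi>0 where "\<Xi>0 = \<xi>_q + s ?q *\<^sub>R M0 - ((s ?q)\<^sup>2 / 2) *\<^sub>R \<eta>_q"
  obtain d \<phi> where d: "d > 0" "{u0 - d..u0 + d} \<subseteq> {u0 - e..u0 + e}"
    and \<phi>0: "\<phi> u0 = (\<Xi>0, M0, \<eta>_q, n2_q, p_q - (s ?q / \<nu> ?q) *\<^sub>R \<eta>_q)"
    and \<phi>: "\<And>t. t \<in> {u0 - d<..<u0 + d} \<Longrightarrow> (\<phi> has_vector_derivative A t (\<phi> t)) (at t)"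
    by (rule linear_ode_local[of "u0 - e" u0 "u0 + e" A "(\<Xi>0, M0, \<eta>_q, n2_q, p_q - (s ?q / \<nu> ?q) *\<^sub>R \<eta>_q)",
          OF _ _ cont lin]) (use e in simp_all)
  \<comment> \<open>The same half-width d serves both directions, since d \<le> e.\<close>
  define D0 where "D0 = {u0 - d<..<u0 + d} \<times> {v0 - d<..<v0 + d}"
  have "d \<le> e" using d by auto
  then have D0D: "D0 \<subseteq> D" using e unfolding D0_def by (force simp: subset_iff)
  have "open D0" unfolding D0_def by (intro open_Times open_greaterThanLessThan)
  have "convex D0" unfolding D0_def by (intro convex_Times convex_real_interval)
  have qD0: "?q \<in> D0" using d by (simp add: D0_def)
  have dom: "planar_domain D0"
    unfolding planar_domain_def using \<open>open D0\<close> convex_connected[OF \<open>convex D0\<close>] qD0 by blast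
  \<comment> \<open>Along the vertical segment through p, which lies in \<open>D0\<close>, a zero
    v-derivative carries the value on v = v0 to p. The equation in u thus holds with the
    coefficients at p itself.\<close>
  have vconst: "g (fst p, v0) = g p" if g: "smooth_on g D" "\<And>p. p \<in> D \<Longrightarrow> pd_v g p = 0" and p: "p \<in> D0"
    for g :: "real \<times> real \<Rightarrow> real" and p
  proof -
    have in_D: "(fst p, t) \<in> D" if "t \<in> {v0 - d<..<v0 + d}" for t
      using p that D0D by (auto simp: D0_def)
    have "((\<lambda>t. g (fst p, t)) has_derivative (\<lambda>h. 0)) (at t within {v0 - d<..<v0 + d})"
      if "t \<in> {v0 - d<..<v0 + d}" for t
      using has_pd_vector_derivative(2)[OF smooth_on_has_pd[OF g(1) in_D[OF that]]]
      by (simp add: g(2)[OF in_D[OF that]] has_vector_derivative_def has_derivative_at_withinI)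
    from has_derivative_zero_unique[OF convex_real_interval(8) this, of v0 "snd p"] show ?thesis
      using p d by (auto simp: D0_def)
  qed
  have \<nu>_v: "pd_v \<nu> p = 0" if "p \<in> D" for p using has_pd_unique(2)[OF pd_\<nu>[OF that]] .
  have const: "\<nu> (fst p, v0) = \<nu> p" "\<rho> (fst p, v0) = \<rho> p" "\<kappa> (fst p, v0) = \<kappa> p"
    "c (fst p, v0) = c p" "\<tau> (fst p, v0) = \<tau> p" if "p \<in> D0" for p
    by (rule vconst[OF _ _ that], rule smooth_\<nu> smooth_\<rho> smooth_\<kappa> smooth_c smooth_\<tau>,
        erule \<nu>_v \<rho>_v \<kappa>_v c_v \<tau>_v)+
  define \<Xi> M \<eta> n2 Z where "\<Xi> p = fst (\<phi> (fst p))" and "M p = fst (snd (\<phi> (fst p)))"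
    and "\<eta> p = fst (snd (snd (\<phi> (fst p))))" and "n2 p = fst (snd (snd (snd (\<phi> (fst p)))))"
    and "Z p = snd (snd (snd (snd (\<phi> (fst p)))))" for p :: "real \<times> real"
  have pd\<Xi>: "has_pd \<Xi> (\<rho> p *\<^sub>R M p + \<kappa> p *\<^sub>R n2 p) 0 p"
    and pdM: "has_pd M (- \<nu> p *\<^sub>R \<Xi> p + \<rho> p *\<^sub>R \<eta> p + c p *\<^sub>R n2 p) 0 p"
    and pd\<eta>: "has_pd \<eta> (- \<nu> p *\<^sub>R M p) 0 p"
    and pdn2: "has_pd n2 (\<kappa> p *\<^sub>R \<eta> p - c p *\<^sub>R M p) 0 p"
    and pdZ: "has_pd Z (\<Xi> p + \<tau> p *\<^sub>R \<eta> p) 0 p" if p: "p \<in> D0" for p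
  proof -
    have "fst p \<in> {u0 - d<..<u0 + d}" using p by (auto simp: D0_def)
    note dv = \<phi>[OF this]
    note d1 = bounded_linear.has_vector_derivative[OF bounded_linear_fst]
      and d2 = bounded_linear.has_vector_derivative[OF bounded_linear_snd]
    note pds = has_pd_fst[OF d1[OF dv]] has_pd_fst[OF d1[OF d2[OF dv]]] has_pd_fst[OF d1[OF d2[OF d2[OF dv]]]]
      has_pd_fst[OF d1[OF d2[OF d2[OF d2[OF dv]]]]] has_pd_fst[OF d2[OF d2[OF d2[OF d2[OF dv]]]]]
    note coords = \<Xi>_def[symmetric] M_def[symmetric] \<eta>_def[symmetric] n2_def[symmetric] Z_def[symmetric]
    show "has_pd \<Xi> (\<rho> p *\<^sub>R M p + \<kappa> p *\<^sub>R n2 p) 0 p"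
      "has_pd M (- \<nu> p *\<^sub>R \<Xi> p + \<rho> p *\<^sub>R \<eta> p + c p *\<^sub>R n2 p) 0 p"
      "has_pd \<eta> (- \<nu> p *\<^sub>R M p) 0 p"
      "has_pd n2 (\<kappa> p *\<^sub>R \<eta> p - c p *\<^sub>R M p) 0 p"
      "has_pd Z (\<Xi> p + \<tau> p *\<^sub>R \<eta> p) 0 p"
      using pds unfolding A_def case_prod_beta coords by (simp_all add: const[OF p])
  qed
  note sm = smooth_\<rho>[THEN smooth_on_subset, OF D0D] smooth_\<kappa>[THEN smooth_on_subset, OF D0D]
    smooth_\<nu>[THEN smooth_on_subset, OF D0D] smooth_c[THEN smooth_on_subset, OF D0D]
    smooth_\<tau>[THEN smooth_on_subset, OF D0D]
  note ck = sm[unfolded smooth_on_def, rule_format]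
  \<comment> \<open>The five fields are coupled, so their regularity is raised
    simultaneously.\<close>
  have cks: "ck_on k \<Xi> D0 \<and> ck_on k M D0 \<and> ck_on k \<eta> D0 \<and> ck_on k n2 D0 \<and> ck_on k Z D0" for k
  proof (induction k)
    case 0
    have cont0: "continuous_on D0 g" if "\<And>p. p \<in> D0 \<Longrightarrow> has_pd g (gu p) 0 p" for g gu :: "real \<times> real \<Rightarrow> real^4"
      using that unfolding has_pd_def
      by (intro continuous_at_imp_continuous_on ballI) (blast intro: has_derivative_continuous)
    show ?case unfolding ck_on.simps(1)
      by (intro conjI; rule cont0; erule pd\<Xi> pdM pd\<eta> pdn2 pdZ)
  next
    case (Suc k)
    note IH = Suc[THEN conjunct1] Suc[THEN conjunct2, THEN conjunct1] Suc[THEN conjunct2, THEN conjunct2, THEN conjunct1]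
      Suc[THEN conjunct2, THEN conjunct2, THEN conjunct2, THEN conjunct1]
    note mult = bounded_bilinear.ck_on[OF bounded_bilinear_scaleR \<open>open D0\<close>]
      bounded_linear.ck_on[OF bounded_linear_minus[OF bounded_linear_ident] \<open>open D0\<close>]
    have diff: "ck_on k (\<lambda>p. a p - b p) D0" if "ck_on k a D0" "ck_on k b D0" for a b :: "real \<times> real \<Rightarrow> real^4"
      using ck_on_add[OF \<open>open D0\<close> that(1) mult(2)[OF that(2)]] by simp
    show ?case
      by (intro conjI ck_on_Suc_pd[OF \<open>open D0\<close> pd\<Xi>] ck_on_Suc_pd[OF \<open>open D0\<close> pdM]
          ck_on_Suc_pd[OF \<open>open D0\<close> pd\<eta>] ck_on_Suc_pd[OF \<open>open D0\<close> pdn2] ck_on_Suc_pd[OF \<open>open D0\<close> pdZ]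
          ck_on_add[OF \<open>open D0\<close>] diff mult IH ck)
  qed
  then have smn2: "smooth_on n2 D0" and smZ: "smooth_on Z D0" and sm\<eta>: "smooth_on \<eta> D0"
    by (simp_all add: smooth_on_def)
  \<comment> \<open>The change of fields undone at each point: the polynomial flow with parameter
    -s.\<close>
  define n1 where "n1 p = M p - s p *\<^sub>R \<eta> p" for p
  define \<xi> where "\<xi> p = \<Xi> p - s p *\<^sub>R M p + ((s p)\<^sup>2 / 2) *\<^sub>R \<eta> p" for p
  define z where "z p = (s p / \<nu> p) *\<^sub>R \<eta> p + Z p" for p
  have "frame_system D0 F L \<nu> (\<lambda>p. F p * lam1 p) \<beta> c \<xi> \<eta> n1 n2"
    unfolding frame_system_def
  proof (intro ballI conjI)
    fix p assume p: "p \<in> D0"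
    then have pD: "p \<in> D" using D0D by blast
    note pds = pd\<Xi>[OF p] pdM[OF p] pd\<eta>[OF p] pdn2[OF p] pd_s[OF pD]
    have "has_pd (\<lambda>p. (s p)\<^sup>2 / 2) (s p * pd_u s p) (s p * (F p * \<nu> p)) p"
      by (rule has_pd_eq_rhs[OF has_pd_divide[OF has_pd_power2[OF pd_s[OF pD]] has_pd_const]]) simp_all
    note pds = pds this
    note coeffs = n1_def \<xi>_def \<rho>_def \<kappa>_def L_eq[OF pD]
    show "has_pd \<xi> (L p *\<^sub>R \<xi> p + (F p * lam1 p) *\<^sub>R n1 p + \<beta> p *\<^sub>R n2 p) (- (F p * \<nu> p) *\<^sub>R n1 p) p"
      unfolding \<xi>_def[abs_def]
      by (rule has_pd_eq_rhs, (rule has_pd_add has_pd_diff has_pd_scaleR pds)+)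
        (simp_all add: coeffs vec_eq_iff field_simps power2_eq_square)
    show "has_pd \<eta> (- L p *\<^sub>R \<eta> p - \<nu> p *\<^sub>R n1 p) 0 p"
      by (rule has_pd_eq_rhs, rule pds) (simp_all add: coeffs algebra_simps)
    show "has_pd n1 (- \<nu> p *\<^sub>R \<xi> p + (F p * lam1 p) *\<^sub>R \<eta> p + c p *\<^sub>R n2 p) (- (F p * \<nu> p) *\<^sub>R \<eta> p) p"
      unfolding n1_def[abs_def]
      by (rule has_pd_eq_rhs, (rule has_pd_add has_pd_diff has_pd_scaleR pds)+)
        (simp_all add: coeffs vec_eq_iff field_simps power2_eq_square)
    show "has_pd n2 (\<beta> p *\<^sub>R \<eta> p - c p *\<^sub>R n1 p) 0 p"
      by (rule has_pd_eq_rhs, rule pds) (simp_all add: coeffs algebra_simps)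
  qed
  moreover have "has_pd z (\<xi> p) (F p *\<^sub>R \<eta> p) p" if p: "p \<in> D0" for p
  proof -
    have pD: "p \<in> D" using p D0D by blast
    show ?thesis
      unfolding z_def[abs_def]
      by (rule has_pd_eq_rhs, (rule has_pd_add has_pd_scaleR pd\<eta>[OF p] pdZ[OF p] pd_s_\<nu>[OF pD])+)
        (use \<nu>_nz[OF pD] in \<open>simp_all add: \<xi>_def \<tau>_def algebra_simps\<close>)
  qed
  moreover have "smooth_on z D0"
    unfolding z_def[abs_def]
    by (intro smooth_on_add smooth_on_scaleR \<open>open D0\<close> smooth_on_subset[OF smooth_s_\<nu> D0D] sm\<eta> smZ)
  moreover have "z ?q = p_q" "\<xi> ?q = \<xi>_q" "\<eta> ?q = \<eta>_q" "n1 ?q = n1_q" "n2 ?q = n2_q"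
    by (simp_all add: z_def \<xi>_def n1_def \<Xi>_def M_def \<eta>_def n2_def Z_def \<phi>0 \<Xi>0_def M0_def)
  ultimately show thesis
    using that[OF dom D0D qD0] smn2 by blast
qed

end

theorem theorem3p4:
  fixes D :: "(real \<times> real) set"
    and f lam1 mu1 :: "real \<times> real \<Rightarrow> real"
    and u0 v0 :: real
    and p0 x0 y0 n10 n20 :: "real^4"
  assumes "planar_domain D"
    and "smooth_on f D" and "smooth_on lam1 D" and "smooth_on mu1 D"
    and "\<forall>p\<in>D. f p > 0" and "\<forall>p\<in>D. mu1 p \<noteq> 0"
    and "\<forall>p\<in>D. pd_v (pd_u (ln_sq f)) p > 0"
    and "\<forall>p\<in>D. pd_v (\<lambda>q. pd_v (pd_u (ln_sq f)) q / (f q)\<^sup>2) p = 0"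
    and "\<forall>p\<in>D. pd_v lam1 p + lam1 p * pd_v (ln_sq f) p
                 + pd_u (\<lambda>q. sqrt (pd_v (pd_u (ln_sq f)) q) / f q) p = 0"
    and "\<forall>p\<in>D. pd_v (pd_v mu1) p + pd_v mu1 p * pd_v (ln_sq f) p + mu1 p * pd_v (pd_v (ln_sq f)) p = 0"
    and "(u0, v0) \<in> D"
    and "pseudo_orthonormal_frame x0 y0 n10 n20"
  shows "\<exists>D0. planar_domain D0 \<and> D0 \<subseteq> D \<and> (u0, v0) \<in> D0 \<and>
           (\<exists>z. surface_with_data D0 f lam1 mu1 (u0, v0) p0 x0 y0 n10 n20 z \<and>
                (\<forall>w. surface_with_data D0 f lam1 mu1 (u0, v0) p0 x0 y0 n10 n20 w \<longrightarrow>
                     (\<forall>p\<in>D0. w p = z p)))"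
proof -
  interpret third_type_data D f lam1 mu1
    by standard (use assms in \<open>auto simp: planar_domain_def\<close>)
  let ?q = "(u0, v0)"
  \<comment> \<open>The prescribed x0, y0 belong to z_u / f and z_v / f, so \<xi> and \<eta> start
    at f x0 and y0 / f.\<close>
  obtain D0 \<xi> \<eta> n1 n2 z where D0: "planar_domain D0" "D0 \<subseteq> D" "?q \<in> D0"
    and sys: "frame_system D0 F L \<nu> (\<lambda>p. F p * lam1 p) \<beta> c \<xi> \<eta> n1 n2"
    and z: "smooth_on z D0" "\<And>p. p \<in> D0 \<Longrightarrow> has_pd z (\<xi> p) (F p *\<^sub>R \<eta> p) p" and n2: "smooth_on n2 D0"
    and init: "z ?q = p0" "\<xi> ?q = f ?q *\<^sub>R x0" "\<eta> ?q = (1 / f ?q) *\<^sub>R y0" "n1 ?q = n10" "n2 ?q = n20"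
    by (rule frame_system_exists[OF assms(11), where p_q = p0 and \<xi>_q = "f ?q *\<^sub>R x0"
      and \<eta>_q = "(1 / f ?q) *\<^sub>R y0" and n1_q = n10 and n2_q = n20]) blast
  have oc: "open D0" "connected D0" using D0 by (auto simp: planar_domain_def)
  note sm = smooth[THEN smooth_on_subset, OF D0(2)]
  have f0: "f p > 0" if "p \<in> D0" for p using f_pos D0 that by blast
  have fr_q: "null_frame (\<xi> ?q) (\<eta> ?q) (n1 ?q) (n2 ?q)"
    using assms(12) f0[OF D0(3)]
    by (simp add: init null_frame_def pseudo_orthonormal_frame_def mink_simps)
  have fr: "null_frame (\<xi> p) (\<eta> p) (n1 p) (n2 p)" if "p \<in> D0" for p
    by (rule frame_system_null_frame[OF oc sys that D0(3) fr_q])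
  have "surface_with_data D0 f lam1 mu1 ?q p0 x0 y0 n10 n20 z"
  proof (rule surface_with_data_of_frame_system[OF D0(1,3) sm(1) f0])
    show "frame_system D0 (\<lambda>p. (f p)\<^sup>2) L \<nu> (\<lambda>p. (f p)\<^sup>2 * lam1 p) (\<lambda>p. (f p)\<^sup>2 * mu1 p) c \<xi> \<eta> n1 n2"
      using sys unfolding \<beta>_def[abs_def] F_def[abs_def] .
    show "has_pd z (\<xi> p) ((f p)\<^sup>2 *\<^sub>R \<eta> p) p" if "p \<in> D0" for p
      using z(2)[OF that] unfolding F_def .
  qed (use fr z n2 init \<nu>_pos assms(6) D0 in auto)
  moreover have "w p = z p"
    if w: "surface_with_data D0 f lam1 mu1 ?q p0 x0 y0 n10 n20 w" and p: "p \<in> D0" for w p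
  proof -
    \<comment> \<open>The competing surface solves the system with the same coefficients and the
      same initial frame, hence has the same \<xi> and \<eta>. Then w and z have equal derivatives
      and agree at the base point of the connected set \<open>D0\<close>.\<close>
    obtain \<xi>' \<eta>' n1' n2'
      where sys': "frame_system D0 F L \<nu> (\<lambda>p. F p * lam1 p) \<beta> c \<xi>' \<eta>' n1' n2'"
        and pdw: "\<And>p. p \<in> D0 \<Longrightarrow> has_pd w (\<xi>' p) (F p *\<^sub>R \<eta>' p) p"
        and init': "w ?q = p0" "\<xi>' ?q = f ?q *\<^sub>R x0" "\<eta>' ?q = (1 / f ?q) *\<^sub>R y0" "n1' ?q = n10" "n2' ?q = n20"
      using frame_system_of_surface[OF D0(3) sm(1) f0 sm(3) sm(2) w]
      unfolding c_def[abs_def] \<nu>_def[abs_def] \<beta>_def[abs_def] F_def[abs_def] L_def by blast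
    have eq: "\<xi>' r = \<xi> r" "\<eta>' r = \<eta> r" if "r \<in> D0" for r
      using frame_system_unique(1,2)[OF oc sys sys' that D0(3) fr_q] init init' by simp_all
    have "((\<lambda>r. w r - z r) has_derivative (\<lambda>h. 0)) (at r)" if "r \<in> D0" for r
      using has_pd_diff[OF pdw[OF that] z(2)[OF that]] by (simp add: eq[OF that] has_pd_def)
    from has_derivative_zero_unique_connected[OF oc this p D0(3)] show ?thesis
      by (simp add: init(1) init'(1))
  qed
  ultimately show ?thesis using D0 by blast
qed

end
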